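(* Let $(X,\mathcal A,\nu)$ be a measure space and let $H$ be a reproducing kernel Hilbert space on $X$ with measurable kernel $k$ such that $H$ is compactly embedded into $L^2(\nu)$. Let $\kappa>0$, $0<\theta<1$, $1\le r\le\infty$, and let $r'\in[1,\infty]$ satisfy $\frac1r+\frac1{r'}=1$. Consider the following statements: (i) $\displaystyle\sup_{x\in X}\left\|\left(e_i(x)\mu_i^\theta\right)_{i\in I}\right\|_{(\mu,\theta,r')}\le\kappa$. (ii) $\displaystyle\operatorname*{ess\,sup}_{x\in X}\left\|\left(e_i(x)\mu_i^\theta\right)_{i\in I}\right\|_{(\mu,\theta,r')}\le\kappa$ (essential supremum with respect to $\nu$). (iii) The embedding $[H]_\sim^{(\theta,r)}\hookrightarrow L^\infty(\nu)$ exists and is continuous with operator norm at most $\kappa$. Then (i) $\Rightarrow$ (ii) $\Rightarrow$ (iii) always holds. Moreover, if in addition $\nu$ is $\sigma$-finite and $k$ is bounded, then (i) $\Rightarrow$ (ii) $\Leftrightarrow$ (iii). And if in addition (to the assumptions of the first two sentences) $L^2(\nu)$ is separable and $\nu$ is $\tau(H)$-positive, then (i) $\Leftrightarrow$ (ii) $\Leftrightarrow$ (iii).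
   Context: All vector spaces are real; $\frac1\infty:=0$. $[f]_\sim$ denotes the $\nu$-a.e. equivalence class of a measurable $f:X\to\mathbb R$. For normed spaces, $E\hookrightarrow F$ means $E\subset F$ with continuous inclusion. $\tau(H)$ is the coarsest topology on $X$ for which all functions in $H$ are continuous. For a topology $\mathcal T$ on $X$, $\nu$ is called $\mathcal T$-positive if $\mathcal T\subset\mathcal A$ and $\nu(A)>0$ for all non-empty $A\in\mathcal T$. $H$ being compactly embedded into $L^2(\nu)$ means that $I_k:H\to L^2(\nu)$, $f\mapsto[f]_\sim$, is a well-defined compact operator. Put $T_k:=I_kI_k^*:L^2(\nu)\to L^2(\nu)$. Its non-zero eigenvalues (with multiplicity) in non-increasing order are $(\mu_i)_{i\in I}$, with $I=\{1,\dots,n\}$ or $I=\mathbb N$; so $\mu_i>0$. There are functions $e_i\in H$ such that $([e_i]_\sim)_{i\in I}$ is an orthonormal system in $L^2(\nu)$ with $T_k[e_i]_\sim=\mu_i[e_i]_\sim$ and $(\sqrt{\mu_i}\,e_i)_{i\in I}$ is an orthonormal system in $H$; such functions are fixed. For $j\in\mathbb Z$ let $M_j:=\{i\in I:2^j<\mu_i\le2^{j+1}\}$. For $1\le q\le\infty$ and a real sequence $b=(b_i)_{i\in I}$ put $c_j(b):=\left(\sum_{i\in M_j}b_i^2\mu_i^{-\theta}\right)^{1/2}$, $\|b\|_{(\mu,\theta,q)}:=\|(c_j(b))_{j\in\mathbb Z}\|_{\ell^q(\mathbb Z)}\in[0,\infty]$ and $\ell^{(\mu,\theta,q)}:=\{b:\|b\|_{(\mu,\theta,q)}<\infty\}$.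 The power space is $[H]_\sim^{(\theta,r)}:=\{f\in L^2(\nu):\exists b\in\ell^{(\mu,\theta,r)}\text{ with }f=\sum_{i\in I}b_i[e_i]_\sim\}$ (series convergent in $L^2(\nu)$), with norm $\left\|\sum_{i\in I}b_i[e_i]_\sim\right\|_{[H]_\sim^{(\theta,r)}}:=\|b\|_{(\mu,\theta,r)}$. *)

theory Defs
  imports "HOL-Analysis.Analysis" "HOL-Probability.Essential_Supremum"
begin

section \<open>Classes of almost everywhere equal functions\<close>

(* A function on X = space M is represented either by an element of extensional X
   (elements of the space H) or by any total function, whose values outside X are ignored
   by measurability, integrals and AE (elements of the classes). *)

definition ae_class :: "'a measure \<Rightarrow> ('a \<Rightarrow> real) \<Rightarrow> ('a \<Rightarrow> real) set" where
  "ae_class M f = {g \<in> borel_measurable M. AE x in M. g x = f x}"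

definition ae_rep :: "('a \<Rightarrow> real) set \<Rightarrow> 'a \<Rightarrow> real" where
  "ae_rep F = (SOME f. f \<in> F)"

definition class_diff ::
    "'a measure \<Rightarrow> ('a \<Rightarrow> real) set \<Rightarrow> ('a \<Rightarrow> real) set \<Rightarrow> ('a \<Rightarrow> real) set" where
  "class_diff M F G = ae_class M (\<lambda>x. ae_rep F x - ae_rep G x)"

definition class_scale :: "'a measure \<Rightarrow> real \<Rightarrow> ('a \<Rightarrow> real) set \<Rightarrow> ('a \<Rightarrow> real) set" where
  "class_scale M c F = ae_class M (\<lambda>x. c * ae_rep F x)"

definition class_lincomb ::
    "'a measure \<Rightarrow> 'i set \<Rightarrow> ('i \<Rightarrow> real) \<Rightarrow> ('i \<Rightarrow> ('a \<Rightarrow> real) set) \<Rightarrow> ('a \<Rightarrow> real) set" where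
  "class_lincomb M A c \<Psi> = ae_class M (\<lambda>x. \<Sum>i\<in>A. c i * ae_rep (\<Psi> i) x)"

section \<open>The spaces of square integrable and of essentially bounded classes\<close>

definition square_integrable :: "'a measure \<Rightarrow> ('a \<Rightarrow> real) set" where
  "square_integrable M = {f \<in> borel_measurable M. integrable M (\<lambda>x. (f x)\<^sup>2)}"

definition L2 :: "'a measure \<Rightarrow> ('a \<Rightarrow> real) set set" where
  "L2 M = ae_class M ` square_integrable M"

definition L2_inner :: "'a measure \<Rightarrow> ('a \<Rightarrow> real) set \<Rightarrow> ('a \<Rightarrow> real) set \<Rightarrow> real" where
  "L2_inner M F G = (LINT x|M. ae_rep F x * ae_rep G x)"

definition L2_norm :: "'a measure \<Rightarrow> ('a \<Rightarrow> real) set \<Rightarrow> real" where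
  "L2_norm M F = sqrt (L2_inner M F F)"

definition L2_topology :: "'a measure \<Rightarrow> ('a \<Rightarrow> real) set topology" where
  "L2_topology M = Metric_space.mtopology (L2 M) (\<lambda>F G. L2_norm M (class_diff M F G))"

definition Linf_norm :: "'a measure \<Rightarrow> ('a \<Rightarrow> real) set \<Rightarrow> ennreal" where
  "Linf_norm M F = esssup M (\<lambda>x. ennreal \<bar>ae_rep F x\<bar>)"

definition Linf :: "'a measure \<Rightarrow> ('a \<Rightarrow> real) set set" where
  "Linf M = {F \<in> ae_class M ` borel_measurable M. Linf_norm M F < \<infinity>}"

section \<open>Reproducing kernel Hilbert spaces\<close>

(* The value outside H is immaterial: Metric_space asks for a distance that is symmetric and
   non-negative on the whole type. *)
definition function_dist ::
    "'a set \<Rightarrow> ('a \<Rightarrow> real) set \<Rightarrow> (('a \<Rightarrow> real) \<Rightarrow> ('a \<Rightarrow> real) \<Rightarrow> real)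
       \<Rightarrow> ('a \<Rightarrow> real) \<Rightarrow> ('a \<Rightarrow> real) \<Rightarrow> real" where
  "function_dist X H ip f g =
     (if f \<in> H \<and> g \<in> H then sqrt (ip (\<lambda>x\<in>X. f x - g x) (\<lambda>x\<in>X. f x - g x)) else 0)"

(* H is a Hilbert space of functions on X, with pointwise operations and inner product ip,
   and k is its reproducing kernel. *)

locale rkhs =
  fixes X :: "'a set"
    and H :: "('a \<Rightarrow> real) set"
    and ip :: "('a \<Rightarrow> real) \<Rightarrow> ('a \<Rightarrow> real) \<Rightarrow> real"
    and k :: "'a \<Rightarrow> 'a \<Rightarrow> real"
  assumes functions_on: "H \<subseteq> extensional X"
    and zero_closed: "(\<lambda>x\<in>X. 0) \<in> H"
    and add_closed: "\<lbrakk>f \<in> H; g \<in> H\<rbrakk> \<Longrightarrow> (\<lambda>x\<in>X. f x + g x) \<in> H"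
    and scale_closed: "f \<in> H \<Longrightarrow> (\<lambda>x\<in>X. c * f x) \<in> H"
    and ip_commute: "\<lbrakk>f \<in> H; g \<in> H\<rbrakk> \<Longrightarrow> ip f g = ip g f"
    and ip_add: "\<lbrakk>f \<in> H; g \<in> H; h \<in> H\<rbrakk> \<Longrightarrow> ip (\<lambda>x\<in>X. f x + g x) h = ip f h + ip g h"
    and ip_scale: "\<lbrakk>f \<in> H; g \<in> H\<rbrakk> \<Longrightarrow> ip (\<lambda>x\<in>X. c * f x) g = c * ip f g"
    and ip_nonneg: "f \<in> H \<Longrightarrow> 0 \<le> ip f f"
    and ip_definite: "\<lbrakk>f \<in> H; ip f f = 0\<rbrakk> \<Longrightarrow> f = (\<lambda>x\<in>X. 0)"
    and complete: "Metric_space.mcomplete H (function_dist X H ip)"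
    and kernel_section: "x \<in> X \<Longrightarrow> (\<lambda>y\<in>X. k y x) \<in> H"
    and reproducing: "\<lbrakk>f \<in> H; x \<in> X\<rbrakk> \<Longrightarrow> f x = ip f (\<lambda>y\<in>X. k y x)"

definition bounded_kernel :: "'a set \<Rightarrow> ('a \<Rightarrow> 'a \<Rightarrow> real) \<Rightarrow> bool" where
  "bounded_kernel X k \<longleftrightarrow> (\<exists>B. \<forall>x\<in>X. \<forall>y\<in>X. \<bar>k x y\<bar> \<le> B)"

(* The open sets of X generated by the preimages; this is a topology on all of X as soon as
   H is non-empty. *)
definition initial_topology :: "'a set \<Rightarrow> ('a \<Rightarrow> real) set \<Rightarrow> 'a topology" where
  "initial_topology X H = topology_generated_by {f -` U \<inter> X |f U. f \<in> H \<and> open U}"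

definition topology_positive :: "'a topology \<Rightarrow> 'a measure \<Rightarrow> bool" where
  "topology_positive T M \<longleftrightarrow>
     (\<forall>A. openin T A \<longrightarrow> A \<in> sets M) \<and> (\<forall>A. openin T A \<and> A \<noteq> {} \<longrightarrow> emeasure M A > 0)"

section \<open>The embedding into the square integrable classes and its spectral data\<close>

(* The map f |-> [f] is linear; it is compact iff the closed unit ball of H has relatively
   compact image. *)
definition compactly_embedded ::
    "'a measure \<Rightarrow> ('a \<Rightarrow> real) set \<Rightarrow> (('a \<Rightarrow> real) \<Rightarrow> ('a \<Rightarrow> real) \<Rightarrow> real) \<Rightarrow> bool" where
  "compactly_embedded M H ip \<longleftrightarrow>
     H \<subseteq> square_integrable M \<and>
     compactin (L2_topology M)
       (L2_topology M closure_of (ae_class M ` {f \<in> H. sqrt (ip f f) \<le> 1}))"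

definition embedding_adjoint ::
    "'a measure \<Rightarrow> ('a \<Rightarrow> real) set \<Rightarrow> (('a \<Rightarrow> real) \<Rightarrow> ('a \<Rightarrow> real) \<Rightarrow> real)
       \<Rightarrow> ('a \<Rightarrow> real) set \<Rightarrow> 'a \<Rightarrow> real" where
  "embedding_adjoint M H ip G =
     (THE h. h \<in> H \<and> (\<forall>f\<in>H. ip f h = L2_inner M (ae_class M f) G))"

definition kernel_operator ::
    "'a measure \<Rightarrow> ('a \<Rightarrow> real) set \<Rightarrow> (('a \<Rightarrow> real) \<Rightarrow> ('a \<Rightarrow> real) \<Rightarrow> real)
       \<Rightarrow> ('a \<Rightarrow> real) set \<Rightarrow> ('a \<Rightarrow> real) set" where
  "kernel_operator M H ip G = ae_class M (embedding_adjoint M H ip G)"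

definition eigenspace ::
    "'a measure \<Rightarrow> (('a \<Rightarrow> real) set \<Rightarrow> ('a \<Rightarrow> real) set) \<Rightarrow> real \<Rightarrow> ('a \<Rightarrow> real) set set" where
  "eigenspace M T l = {F \<in> L2 M. T F = class_scale M l F}"

definition has_dimension :: "'a measure \<Rightarrow> ('a \<Rightarrow> real) set set \<Rightarrow> nat \<Rightarrow> bool" where
  "has_dimension M E n \<longleftrightarrow>
     (\<exists>\<Psi>. (\<forall>i<n. \<Psi> i \<in> E)
        \<and> E = range (\<lambda>c. class_lincomb M {..<n} c \<Psi>)
        \<and> (\<forall>c. class_lincomb M {..<n} c \<Psi> = ae_class M (\<lambda>x. 0) \<longrightarrow> (\<forall>i<n. c i = 0)))"

(* Non-zero eigenvalues, listed with multiplicity in non-increasing order; the set I may be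
   empty (n = 0), namely when T = 0. *)
definition eigenvalue_enumeration ::
    "'a measure \<Rightarrow> (('a \<Rightarrow> real) set \<Rightarrow> ('a \<Rightarrow> real) set) \<Rightarrow> nat set \<Rightarrow> (nat \<Rightarrow> real) \<Rightarrow> bool" where
  "eigenvalue_enumeration M T I \<mu> \<longleftrightarrow>
     ((\<exists>n. I = {1..n}) \<or> I = {1..})
     \<and> (\<forall>i\<in>I. \<mu> i \<noteq> 0)
     \<and> (\<forall>i\<in>I. \<forall>j\<in>I. i \<le> j \<longrightarrow> \<mu> j \<le> \<mu> i)
     \<and> (\<forall>l. l \<noteq> 0 \<longrightarrow> finite {i \<in> I. \<mu> i = l}
                    \<and> has_dimension M (eigenspace M T l) (card {i \<in> I. \<mu> i = l}))"

definition eigenfunctions ::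
    "'a measure \<Rightarrow> ('a \<Rightarrow> real) set \<Rightarrow> (('a \<Rightarrow> real) \<Rightarrow> ('a \<Rightarrow> real) \<Rightarrow> real)
       \<Rightarrow> nat set \<Rightarrow> (nat \<Rightarrow> real) \<Rightarrow> (nat \<Rightarrow> 'a \<Rightarrow> real) \<Rightarrow> bool" where
  "eigenfunctions M H ip I \<mu> e \<longleftrightarrow>
     (\<forall>i\<in>I. e i \<in> H)
     \<and> (\<forall>i\<in>I. \<forall>j\<in>I. L2_inner M (ae_class M (e i)) (ae_class M (e j)) = (if i = j then 1 else 0))
     \<and> (\<forall>i\<in>I. kernel_operator M H ip (ae_class M (e i)) = class_scale M (\<mu> i) (ae_class M (e i)))
     \<and> (\<forall>i\<in>I. \<forall>j\<in>I. ip (\<lambda>x\<in>space M. sqrt (\<mu> i) * e i x) (\<lambda>x\<in>space M. sqrt (\<mu> j) * e j x)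
                       = (if i = j then 1 else 0))"

section \<open>Weighted sequence norms and power spaces\<close>

definition lq_norm :: "ennreal \<Rightarrow> (int \<Rightarrow> real) \<Rightarrow> ennreal" where
  "lq_norm q a =
     (if q = \<infinity> then (SUP j. ennreal \<bar>a j\<bar>)
      else let S = (\<integral>\<^sup>+j. ennreal (\<bar>a j\<bar> powr enn2real q) \<partial>count_space UNIV)
           in if S = \<infinity> then \<infinity> else ennreal (enn2real S powr (1 / enn2real q)))"

definition dyadic_block :: "nat set \<Rightarrow> (nat \<Rightarrow> real) \<Rightarrow> int \<Rightarrow> nat set" where
  "dyadic_block I \<mu> j = {i \<in> I. 2 powi j < \<mu> i \<and> \<mu> i \<le> 2 powi (j + 1)}"

(* The blocks are finite: the eigenvalues of a compact operator accumulate only at 0. *)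
definition block_norm :: "nat set \<Rightarrow> (nat \<Rightarrow> real) \<Rightarrow> real \<Rightarrow> (nat \<Rightarrow> real) \<Rightarrow> int \<Rightarrow> real" where
  "block_norm I \<mu> \<theta> b j = sqrt (\<Sum>i\<in>dyadic_block I \<mu> j. (b i)\<^sup>2 * \<mu> i powr (- \<theta>))"

definition weighted_norm ::
    "nat set \<Rightarrow> (nat \<Rightarrow> real) \<Rightarrow> real \<Rightarrow> ennreal \<Rightarrow> (nat \<Rightarrow> real) \<Rightarrow> ennreal" where
  "weighted_norm I \<mu> \<theta> q b = lq_norm q (block_norm I \<mu> \<theta> b)"

definition L2_series ::
    "'a measure \<Rightarrow> nat set \<Rightarrow> (nat \<Rightarrow> 'a \<Rightarrow> real) \<Rightarrow> (nat \<Rightarrow> real) \<Rightarrow> ('a \<Rightarrow> real) set \<Rightarrow> bool" where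
  "L2_series M I e b F \<longleftrightarrow>
     limitin (L2_topology M) (\<lambda>n. class_lincomb M (I \<inter> {..n}) b (\<lambda>i. ae_class M (e i))) F
       sequentially"

definition power_space ::
    "'a measure \<Rightarrow> nat set \<Rightarrow> (nat \<Rightarrow> real) \<Rightarrow> (nat \<Rightarrow> 'a \<Rightarrow> real) \<Rightarrow> real \<Rightarrow> ennreal
       \<Rightarrow> ('a \<Rightarrow> real) set set" where
  "power_space M I \<mu> e \<theta> r =
     {F \<in> L2 M. \<exists>b. weighted_norm I \<mu> \<theta> r b < \<infinity> \<and> L2_series M I e b F}"

(* Well defined: the classes of the e i are orthonormal, so F determines b on I. *)
definition power_norm ::
    "'a measure \<Rightarrow> nat set \<Rightarrow> (nat \<Rightarrow> real) \<Rightarrow> (nat \<Rightarrow> 'a \<Rightarrow> real) \<Rightarrow> real \<Rightarrow> ennreal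
       \<Rightarrow> ('a \<Rightarrow> real) set \<Rightarrow> ennreal" where
  "power_norm M I \<mu> e \<theta> r F =
     (THE c. \<exists>b. L2_series M I e b F \<and> c = weighted_norm I \<mu> \<theta> r b)"

definition continuously_embedded ::
    "'a measure \<Rightarrow> ('a \<Rightarrow> real) set set \<Rightarrow> (('a \<Rightarrow> real) set \<Rightarrow> ennreal)
       \<Rightarrow> ('a \<Rightarrow> real) set set \<Rightarrow> (('a \<Rightarrow> real) set \<Rightarrow> ennreal) \<Rightarrow> bool" where
  "continuously_embedded M E nE F nF \<longleftrightarrow>
     E \<subseteq> F \<and>
     (\<forall>u\<in>E. \<forall>\<epsilon>>0. \<exists>\<delta>>0. \<forall>v\<in>E. nE (class_diff M v u) < \<delta> \<longrightarrow> nF (class_diff M v u) < \<epsilon>)"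

definition embedding_norm ::
    "('a \<Rightarrow> real) set set \<Rightarrow> (('a \<Rightarrow> real) set \<Rightarrow> ennreal) \<Rightarrow> (('a \<Rightarrow> real) set \<Rightarrow> ennreal)
       \<Rightarrow> ennreal" where
  "embedding_norm E nE nF = (SUP u\<in>{u \<in> E. nE u \<le> 1}. nF u)"

end

theory Submission
  imports Defs
begin

text \<open>
  For coefficients \<open>b\<close> and a point \<open>x\<close>, the value \<open>\<Sum>i. b i * e i x\<close> is the pairing of \<open>b\<close> with the sequence
  \<open>e i x * \<mu> i powr \<theta>\<close>, and the weighted norms with conjugate exponents are dual for this pairing. The three
  statements say that the second sequence lies in the ball of radius \<open>\<kappa>\<close> of the dual norm everywhere,
  almost everywhere, or after testing with all \<open>b\<close> of norm at most 1.

  If the bound holds almost everywhere, then Hoelder's inequality (\<open>weighted_Holder\<close>) bounds all partial sums of a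
  series with norm at most 1 by \<open>\<kappa>\<close> almost everywhere, and this survives the limit in \<open>L2\<close>
  (\<open>L2_limit_abs_le\<close>); that is the embedding with operator norm at most \<open>\<kappa>\<close>. Conversely, if the embedding has
  norm at most \<open>\<kappa>\<close>, then every finite combination \<open>\<Sum>i. b i * e i\<close> with \<open>b\<close> in the unit ball is
  bounded by \<open>\<kappa>\<close> almost everywhere. Rational \<open>b\<close> of finite support determine the dual norm
  (\<open>weighted_norm_le_by_rational_duality\<close>), and there are only countably many of them, so the exceptional sets
  unite to a null set outside of which the dual norm is at most \<open>\<kappa>\<close>.

  If non-empty open sets of the initial topology have positive measure, the exceptional set of a finite
  combination, being open by continuity of the functions in \<open>H\<close>, is empty, and the same duality gives
  the bound at every point.

  For these arguments to apply, every index must lie in a finite dyadic block. The eigenvalues are positive because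
  the operator is the product of the embedding and its adjoint, where the adjoint exists by the Riesz
  representation theorem in \<open>H\<close> (\<open>Riesz_representation\<close>), and only finitely many exceed a given positive number
  because the embedding is compact (\<open>finitely_many_large_eigenvalues\<close>).
\<close>

section \<open>Duality of the sequence norms\<close>

text \<open>Writing the integral as the supremum of one sequence of finite sums makes \<open>lq_norm\<close> visibly measurable
in a parameter and reduces estimates to finite sums.\<close>
lemma nn_integral_count_space_int_SUP:
  fixes f :: "int \<Rightarrow> ennreal"
  shows "(\<integral>\<^sup>+j. f j \<partial>count_space UNIV) = (SUP n. \<Sum>j\<in>{- int n..int n}. f j)"
proof -
  have exhaust: "(SUP n. f j * indicator {- int n..int n} j) = f j" for j
  proof (rule antisym)
    show "(SUP n. f j * indicator {- int n..int n} j) \<le> f j"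
      by (rule SUP_least) (auto simp: indicator_def)
    have "f j = f j * indicator {- int (nat \<bar>j\<bar>)..int (nat \<bar>j\<bar>)} j"
      by (auto simp: indicator_def)
    also have "\<dots> \<le> (SUP n. f j * indicator {- int n..int n} j)"
      by (rule SUP_upper) simp
    finally show "f j \<le> (SUP n. f j * indicator {- int n..int n} j)" .
  qed
  have "(\<integral>\<^sup>+j. f j \<partial>count_space UNIV)
      = (\<integral>\<^sup>+j. (SUP n. f j * indicator {- int n..int n} j) \<partial>count_space UNIV)"
    by (simp only: exhaust)
  also have "\<dots> = (SUP n. \<integral>\<^sup>+j. f j * indicator {- int n..int n} j \<partial>count_space UNIV)"
    by (rule nn_integral_monotone_convergence_SUP)
       (auto simp: incseq_def le_fun_def indicator_def)
  also have "\<dots> = (SUP n. \<Sum>j\<in>{- int n..int n}. f j)"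
    by (simp add: nn_integral_count_space_indicator[symmetric] nn_integral_count_space_finite)
  finally show ?thesis .
qed

lemma nn_integral_count_space_int_le_iff:
  fixes f :: "int \<Rightarrow> ennreal"
  shows "(\<integral>\<^sup>+j. f j \<partial>count_space UNIV) \<le> c \<longleftrightarrow> (\<forall>J. finite J \<longrightarrow> (\<Sum>j\<in>J. f j) \<le> c)"
proof
  assume le: "(\<integral>\<^sup>+j. f j \<partial>count_space UNIV) \<le> c"
  show "\<forall>J. finite J \<longrightarrow> (\<Sum>j\<in>J. f j) \<le> c"
  proof (intro allI impI)
    fix J :: "int set" assume "finite J"
    then have "(\<Sum>j\<in>J. f j) = (\<integral>\<^sup>+j. f j * indicator J j \<partial>count_space UNIV)"
      by (simp add: nn_integral_count_space_indicator[symmetric] nn_integral_count_space_finite)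
    also have "\<dots> \<le> (\<integral>\<^sup>+j. f j \<partial>count_space UNIV)"
      by (rule nn_integral_mono) (auto simp: indicator_def)
    finally show "(\<Sum>j\<in>J. f j) \<le> c" using le by simp
  qed
qed (auto simp: nn_integral_count_space_int_SUP intro: SUP_least)

lemma lq_norm_infinity_le_iff:
  "0 \<le> t \<Longrightarrow> lq_norm \<infinity> a \<le> ennreal t \<longleftrightarrow> (\<forall>j. \<bar>a j\<bar> \<le> t)"
  by (simp add: lq_norm_def SUP_le_iff)

text \<open>For a finite exponent the bound \<open>lq_norm p a \<le> t\<close> is a statement about finite sums of reals. All later
arguments use the norms only through this equivalence and its analogue for the exponent \<open>\<infinity>\<close>, so that no
arithmetic of extended numbers is left.\<close>
lemma lq_norm_le_iff:
  assumes "1 \<le> p" and t: "0 \<le> t"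
  shows "lq_norm (ennreal p) a \<le> ennreal t
    \<longleftrightarrow> (\<forall>J. finite J \<longrightarrow> (\<Sum>j\<in>J. \<bar>a j\<bar> powr p) \<le> t powr p)"
proof -
  define S where "S = (\<integral>\<^sup>+j. ennreal (\<bar>a j\<bar> powr p) \<partial>count_space UNIV)"
  have p: "enn2real (ennreal p) = p" "p > 0" using assms by auto
  have "lq_norm (ennreal p) a = (if S = \<infinity> then \<infinity> else ennreal (enn2real S powr (1 / p)))"
    by (simp add: lq_norm_def p S_def Let_def)
  also have "\<dots> \<le> ennreal t \<longleftrightarrow> S \<le> ennreal (t powr p)"
  proof (cases S)
    case (real s)
    have "s powr (1 / p) \<le> t \<longleftrightarrow> s \<le> t powr p"
    proof
      assume "s powr (1 / p) \<le> t"
      then have "(s powr (1 / p)) powr p \<le> t powr p"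
        using p by (intro powr_mono2) auto
      then show "s \<le> t powr p" using p real by (simp add: powr_powr)
    next
      assume "s \<le> t powr p"
      then have "s powr (1 / p) \<le> (t powr p) powr (1 / p)"
        using p real by (intro powr_mono2) auto
      then show "s powr (1 / p) \<le> t" using p t by (simp add: powr_powr)
    qed
    then show ?thesis using real t by simp
  qed (simp add: top_unique)
  also have "\<dots> \<longleftrightarrow> (\<forall>J. finite J \<longrightarrow> (\<Sum>j\<in>J. \<bar>a j\<bar> powr p) \<le> t powr p)"
    by (simp add: S_def nn_integral_count_space_int_le_iff)
  finally show ?thesis .
qed

lemma ennreal_ge1_cases:
  assumes "1 \<le> (q :: ennreal)"
  obtains (infinity) "q = \<infinity>" | (real) p where "q = ennreal p" "1 \<le> p"
  using assms by (cases q) auto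

text \<open>Since \<open>1 / \<infinity> = 0\<close>, the relation between the exponents leaves the two limiting pairs and the pairs of
real exponents beyond 1, for which Young's inequality is available.\<close>
lemma conjugate_exponent_cases:
  fixes r r' :: ennreal
  assumes "1 \<le> r" "1 \<le> r'" "1 / r + 1 / r' = 1"
  obtains (one_infinity) "r = 1" "r' = \<infinity>"
    | (infinity_one) "r = \<infinity>" "r' = 1"
    | (real) p q where "r = ennreal p" "r' = ennreal q" "1 < p" "1 < q" "1 / p + 1 / q = 1"
proof -
  have inv: "1 / ennreal p = ennreal (1 / p)" if "1 \<le> p" for p
    using that divide_ennreal[of 1 p] by simp
  consider "r = \<infinity>" "r' = \<infinity>" | q where "r = \<infinity>" "r' = ennreal q" "1 \<le> q"
    | p where "r = ennreal p" "r' = \<infinity>" "1 \<le> p"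
    | p q where "r = ennreal p" "r' = ennreal q" "1 \<le> p" "1 \<le> q"
    using assms(1,2) by (metis ennreal_ge1_cases)
  then show thesis
  proof cases
    case 1
    then show thesis using assms(3) by (simp add: divide_ennreal_def)
  next
    case (2 q)
    then have "ennreal (1 / q) = 1" using assms(3) inv by (simp add: divide_ennreal_def)
    then show thesis using 2 that(2) by simp
  next
    case (3 p)
    then have "ennreal (1 / p) = 1" using assms(3) inv by (simp add: divide_ennreal_def)
    then show thesis using 3 that(1) by simp
  next
    case (4 p q)
    then have "ennreal (1 / p + 1 / q) = ennreal (1 / p) + ennreal (1 / q)"
      by (intro ennreal_plus) auto
    also have "\<dots> = 1" using 4 assms(3) inv by metis
    finally have sum: "1 / p + 1 / q = 1" by (simp only: ennreal_eq_1)
    then have "p \<noteq> 1" "q \<noteq> 1" using 4 by auto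
    then show thesis using 4 that(3)[of p q] sum by auto
  qed
qed

lemma abs_le_if_lq_norm_le:
  assumes "1 \<le> q" "0 \<le> t" "lq_norm q a \<le> ennreal t"
  shows "\<bar>a j\<bar> \<le> t"
  using assms(1)
proof (cases rule: ennreal_ge1_cases)
  case infinity
  then show ?thesis using assms lq_norm_infinity_le_iff by blast
next
  case (real p)
  then have "(\<Sum>j\<in>{j}. \<bar>a j\<bar> powr p) \<le> t powr p"
    using assms lq_norm_le_iff by blast
  then have "\<bar>a j\<bar> powr p \<le> t powr p" by simp
  then show ?thesis using powr_less_mono2[of p t "\<bar>a j\<bar>"] real assms by force
qed

lemma lq_norm_le_mono:
  assumes "1 \<le> q" "0 \<le> t" "lq_norm q a \<le> ennreal t" and le: "\<And>j. \<bar>b j\<bar> \<le> \<bar>a j\<bar>"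
  shows "lq_norm q b \<le> ennreal t"
  using assms(1)
proof (cases rule: ennreal_ge1_cases)
  case infinity
  then show ?thesis using assms lq_norm_infinity_le_iff by (meson order_trans)
next
  case (real p)
  have "(\<Sum>j\<in>J. \<bar>b j\<bar> powr p) \<le> t powr p" if "finite J" for J
  proof -
    have "(\<Sum>j\<in>J. \<bar>b j\<bar> powr p) \<le> (\<Sum>j\<in>J. \<bar>a j\<bar> powr p)"
      using real le by (intro sum_mono powr_mono2) auto
    also have "\<dots> \<le> t powr p" using assms real that lq_norm_le_iff by blast
    finally show ?thesis .
  qed
  then show ?thesis using real assms lq_norm_le_iff by blast
qed

text \<open>For real exponents, dividing the sequences by \<open>A\<close> and \<open>B\<close> and adding up Young's inequality over \<open>J\<close> gives
at most \<open>1 / p + 1 / q = 1\<close>.\<close>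
lemma lq_norm_Holder:
  assumes conj: "1 \<le> r" "1 \<le> r'" "1 / r + 1 / r' = 1"
    and A: "0 \<le> A" "lq_norm r a \<le> ennreal A" and B: "0 \<le> B" "lq_norm r' b \<le> ennreal B"
    and J: "finite J"
  shows "(\<Sum>j\<in>J. \<bar>a j * b j\<bar>) \<le> A * B"
proof -
  have a: "\<bar>a j\<bar> \<le> A" and b: "\<bar>b j\<bar> \<le> B" for j
    using abs_le_if_lq_norm_le A B conj by blast+
  show ?thesis using conj
  proof (cases rule: conjugate_exponent_cases)
    case one_infinity
    have "(\<Sum>j\<in>J. \<bar>a j * b j\<bar>) \<le> (\<Sum>j\<in>J. \<bar>a j\<bar> * B)"
      unfolding abs_mult using b by (intro sum_mono mult_left_mono) auto
    also have "\<dots> \<le> A * B"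
      using lq_norm_le_iff[of 1 A a] A B J one_infinity
      by (simp add: sum_distrib_right[symmetric] mult_right_mono)
    finally show ?thesis .
  next
    case infinity_one
    have "(\<Sum>j\<in>J. \<bar>a j * b j\<bar>) \<le> (\<Sum>j\<in>J. A * \<bar>b j\<bar>)"
      unfolding abs_mult using a by (intro sum_mono mult_right_mono) auto
    also have "\<dots> \<le> A * B"
      using lq_norm_le_iff[of 1 B b] A B J infinity_one
      by (simp add: sum_distrib_left[symmetric] mult_left_mono)
    finally show ?thesis .
  next
    case (real p q)
    show ?thesis
    proof (cases "A = 0 \<or> B = 0")
      case True
      then have "\<bar>a j * b j\<bar> = 0" for j using a[of j] b[of j] by auto
      then show ?thesis using A B by (simp only: sum.neutral_const) simp
    next
      case False
      then have pos: "A > 0" "B > 0" using A B by auto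
      have pa: "(\<Sum>j\<in>J. \<bar>a j\<bar> powr p) / A powr p \<le> 1"
        using lq_norm_le_iff[of p A a] A J real pos by simp
      have pb: "(\<Sum>j\<in>J. \<bar>b j\<bar> powr q) / B powr q \<le> 1"
        using lq_norm_le_iff[of q B b] B J real pos by simp
      have "(\<Sum>j\<in>J. \<bar>a j * b j\<bar>) / (A * B) = (\<Sum>j\<in>J. (\<bar>a j\<bar> / A) * (\<bar>b j\<bar> / B))"
        by (simp add: sum_divide_distrib abs_mult)
      also have "\<dots> \<le> (\<Sum>j\<in>J. (\<bar>a j\<bar> / A) powr p / p + (\<bar>b j\<bar> / B) powr q / q)"
        using real pos by (intro sum_mono Youngs_inequality) auto
      also have "\<dots> = (\<Sum>j\<in>J. \<bar>a j\<bar> powr p) / A powr p / p + (\<Sum>j\<in>J. \<bar>b j\<bar> powr q) / B powr q / q"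
        using pos by (simp add: sum.distrib sum_divide_distrib powr_divide)
      also have "\<dots> \<le> 1 / p + 1 / q"
        using pa pb real by (intro add_mono divide_right_mono) auto
      finally show ?thesis using real pos by (simp add: divide_le_eq)
    qed
  qed
qed

text \<open>The converse of Hoelder's inequality. The test sequences in the unit ball are
a unit vector if \<open>r = 1\<close>, the indicator of \<open>J\<close> if \<open>r = \<infinity>\<close>, and
otherwise the normalised power \<open>\<bar>d\<bar> powr (q - 1)\<close> on \<open>J\<close>, for which Hoelder's inequality is an equality.\<close>
lemma lq_norm_le_by_duality:
  assumes conj: "1 \<le> r" "1 \<le> r'" "1 / r + 1 / r' = 1" and K: "0 \<le> K"
    and test: "\<And>J a. \<lbrakk>finite J; \<And>j. 0 \<le> a j; \<And>j. j \<notin> J \<Longrightarrow> a j = 0; lq_norm r a \<le> 1\<rbrakk>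
      \<Longrightarrow> (\<Sum>j\<in>J. a j * \<bar>d j\<bar>) \<le> K"
  shows "lq_norm r' d \<le> ennreal K"
  using conj
proof (cases rule: conjugate_exponent_cases)
  case one_infinity
  have "\<bar>d j\<bar> \<le> K" for j
  proof -
    have "lq_norm r (\<lambda>l. if l = j then 1 else 0) \<le> 1"
    proof -
      have "(\<Sum>l\<in>J. \<bar>if l = j then 1 else 0 :: real\<bar> powr 1) \<le> 1" if "finite J" for J
      proof -
        have "(\<Sum>l\<in>J. \<bar>if l = j then 1 else 0 :: real\<bar> powr 1) = (\<Sum>l\<in>J. if l = j then 1 else 0)"
          by (intro sum.cong) auto
        then show ?thesis using that by simp
      qed
      then show ?thesis using lq_norm_le_iff[of 1 1] one_infinity by simp
    qed
    from test[OF _ _ _ this, of "{j}"] show ?thesis by auto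
  qed
  then show ?thesis using one_infinity K lq_norm_infinity_le_iff by blast
next
  case infinity_one
  have "(\<Sum>j\<in>J. \<bar>d j\<bar>) \<le> K" if "finite J" for J
  proof -
    have "lq_norm r (\<lambda>l. if l \<in> J then 1 else 0) \<le> 1"
      using lq_norm_infinity_le_iff[of 1] infinity_one by simp
    from test[OF that _ _ this] show ?thesis by simp
  qed
  then show ?thesis using lq_norm_le_iff[of 1 K d] infinity_one K by simp
next
  case (real p q)
  have "(\<Sum>j\<in>J. \<bar>d j\<bar> powr q) \<le> K powr q" if J: "finite J" for J
  proof (cases "(\<Sum>j\<in>J. \<bar>d j\<bar> powr q) = 0")
    case False
    define S where "S = (\<Sum>j\<in>J. \<bar>d j\<bar> powr q)"
    have S: "S > 0" using False by (simp add: S_def less_le sum_nonneg)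
    have pq: "(q - 1) * p = q" "1 - 1 / p = 1 / q"
      using real by (auto simp: field_simps)
    define a where "a l = (if l \<in> J then \<bar>d l\<bar> powr (q - 1) / S powr (1 / p) else 0)" for l
    have "(\<Sum>l\<in>L. \<bar>a l\<bar> powr p) \<le> 1" if L: "finite L" for L
    proof -
      have "(\<Sum>l\<in>L. \<bar>a l\<bar> powr p) = (\<Sum>l\<in>L. if l \<in> J then \<bar>d l\<bar> powr q / S else 0)"
        using S real pq by (intro sum.cong) (auto simp: a_def powr_divide powr_powr)
      also have "\<dots> = (\<Sum>l\<in>L \<inter> J. \<bar>d l\<bar> powr q / S)"
        using L by (simp add: sum.inter_restrict)
      also have "\<dots> \<le> (\<Sum>l\<in>J. \<bar>d l\<bar> powr q / S)"
        using J S by (intro sum_mono2) auto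
      also have "\<dots> = 1" using S by (simp add: S_def sum_divide_distrib[symmetric])
      finally show ?thesis .
    qed
    then have "lq_norm r a \<le> 1" using lq_norm_le_iff[of p 1 a] real by simp
    moreover have "0 \<le> a j" "j \<notin> J \<Longrightarrow> a j = 0" for j using S by (auto simp: a_def)
    ultimately have "(\<Sum>j\<in>J. a j * \<bar>d j\<bar>) \<le> K" using J by (intro test)
    also have "(\<Sum>j\<in>J. a j * \<bar>d j\<bar>) = (\<Sum>j\<in>J. \<bar>d j\<bar> powr q / S powr (1 / p))"
    proof (rule sum.cong)
      fix j assume "j \<in> J"
      have "\<bar>d j\<bar> powr (q - 1) * \<bar>d j\<bar> = \<bar>d j\<bar> powr q"
        by (cases "d j = 0") (auto simp: powr_diff)
      then show "a j * \<bar>d j\<bar> = \<bar>d j\<bar> powr q / S powr (1 / p)" using \<open>j \<in> J\<close> by (simp add: a_def)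
    qed simp
    also have "\<dots> = S powr 1 / S powr (1 / p)" using S by (simp add: S_def sum_divide_distrib)
    also have "\<dots> = S powr (1 / q)" using pq by (simp only: powr_diff[symmetric])
    finally have "(S powr (1 / q)) powr q \<le> K powr q" using real by (intro powr_mono2) auto
    then show ?thesis using S real by (simp add: powr_powr S_def)
  qed simp
  then show ?thesis using lq_norm_le_iff[of q K d] real K by simp
qed

lemma borel_measurable_lq_norm:
  assumes [measurable]: "\<And>j. (\<lambda>x. a x j) \<in> borel_measurable M"
  shows "(\<lambda>x. lq_norm q (a x)) \<in> borel_measurable M"
proof (cases "q = \<infinity>")
  case True
  then show ?thesis unfolding lq_norm_def by simp
next
  case False
  have [measurable]:
    "(\<lambda>x. \<integral>\<^sup>+j. ennreal (\<bar>a x j\<bar> powr enn2real q) \<partial>count_space UNIV) \<in> borel_measurable M"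
    unfolding nn_integral_count_space_int_SUP by measurable
  show ?thesis using False unfolding lq_norm_def Let_def by simp
qed

section \<open>Duality of the dyadically weighted norms\<close>

text \<open>Positivity puts every index into exactly one block. Finiteness matters because a sum over an infinite
set is 0 by convention, so that the block norm would lose its meaning.\<close>
locale dyadic_weights =
  fixes I :: "nat set" and \<mu> :: "nat \<Rightarrow> real"
  assumes weight_pos: "i \<in> I \<Longrightarrow> 0 < \<mu> i"
    and finite_block: "finite (dyadic_block I \<mu> j)"
begin

text \<open>The index of the block that contains \<open>i\<close>. The blocks are open on the left and closed on the right, hence the
rounding upwards.\<close>
definition level :: "nat \<Rightarrow> int" where
  "level i = \<lceil>log 2 (\<mu> i)\<rceil> - 1"

lemma mem_dyadic_block_iff: "i \<in> dyadic_block I \<mu> j \<longleftrightarrow> i \<in> I \<and> level i = j"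
proof -
  have "2 powi j < \<mu> i \<and> \<mu> i \<le> 2 powi (j + 1) \<longleftrightarrow> level i = j" if "i \<in> I"
  proof -
    have "2 powi j < \<mu> i \<longleftrightarrow> of_int j < log 2 (\<mu> i)"
      using weight_pos[OF that] by (simp add: less_log_iff flip: powr_real_of_int')
    moreover have "\<mu> i \<le> 2 powi (j + 1) \<longleftrightarrow> log 2 (\<mu> i) \<le> of_int (j + 1)"
      using weight_pos[OF that] by (simp add: log_le_iff flip: powr_real_of_int')
    ultimately show ?thesis unfolding level_def by linarith
  qed
  then show ?thesis by (auto simp: dyadic_block_def)
qed

lemma block_norm_nonneg: "0 \<le> block_norm I \<mu> \<theta> b j"
  by (simp add: block_norm_def sum_nonneg)

lemma weighted_norm_cong:
  assumes "\<And>i. i \<in> I \<Longrightarrow> b i = b' i"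
  shows "weighted_norm I \<mu> \<theta> q b = weighted_norm I \<mu> \<theta> q b'"
proof -
  have "block_norm I \<mu> \<theta> b = block_norm I \<mu> \<theta> b'"
    unfolding block_norm_def using assms
    by (intro ext arg_cong[where f = sqrt] sum.cong) (auto simp: dyadic_block_def)
  then show ?thesis by (simp add: weighted_norm_def)
qed

lemma weighted_norm_le_mono:
  assumes "1 \<le> q" "0 \<le> t" "weighted_norm I \<mu> \<theta> q b \<le> ennreal t"
    and le: "\<And>i. i \<in> I \<Longrightarrow> \<bar>b' i\<bar> \<le> \<bar>b i\<bar>"
  shows "weighted_norm I \<mu> \<theta> q b' \<le> ennreal t"
proof -
  have "\<bar>block_norm I \<mu> \<theta> b' j\<bar> \<le> \<bar>block_norm I \<mu> \<theta> b j\<bar>" for j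
  proof -
    have "(b' i)\<^sup>2 \<le> (b i)\<^sup>2" if "i \<in> I" for i using le[OF that] by (simp add: abs_le_square_iff)
    then have "block_norm I \<mu> \<theta> b' j \<le> block_norm I \<mu> \<theta> b j"
      unfolding block_norm_def
      by (intro real_sqrt_le_mono sum_mono mult_right_mono) (auto simp: dyadic_block_def)
    then show ?thesis by (simp add: block_norm_nonneg)
  qed
  then show ?thesis using assms lq_norm_le_mono unfolding weighted_norm_def by blast
qed

text \<open>The factor \<open>\<mu> i powr \<theta>\<close> turns the weight \<open>-\<theta>\<close> into the dual weight \<open>\<theta>\<close>.\<close>
lemma block_norm_dual:
  "block_norm I \<mu> \<theta> (\<lambda>i. y i * \<mu> i powr \<theta>) j
    = sqrt (\<Sum>i\<in>dyadic_block I \<mu> j. (y i)\<^sup>2 * \<mu> i powr \<theta>)"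
proof -
  have "(y i * \<mu> i powr \<theta>)\<^sup>2 * \<mu> i powr (- \<theta>) = (y i)\<^sup>2 * \<mu> i powr \<theta>"
    if "i \<in> dyadic_block I \<mu> j" for i
  proof -
    have "\<mu> i > 0" using that weight_pos by (simp add: dyadic_block_def)
    then have "\<mu> i powr \<theta> * \<mu> i powr (- \<theta>) = 1" by (simp add: powr_minus)
    then show ?thesis by (simp add: power2_eq_square mult.assoc mult.left_commute)
  qed
  then show ?thesis by (simp add: block_norm_def)
qed

lemma sum_by_levels:
  assumes "finite F" "F \<subseteq> I"
  shows "(\<Sum>i\<in>F. f i) = (\<Sum>j\<in>level ` F. \<Sum>i\<in>F \<inter> dyadic_block I \<mu> j. f i)"
proof -
  have "F \<inter> dyadic_block I \<mu> j = {i \<in> F. level i = j}" for j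
    using assms(2) by (auto simp: mem_dyadic_block_iff)
  then show ?thesis using sum.image_gen[OF assms(1), of f level] by simp
qed

text \<open>Within a block the weights \<open>-\<theta> / 2\<close> and \<open>\<theta> / 2\<close> cancel and the Cauchy-Schwarz inequality bounds the sum by the
product of the two block norms; Hoelder's inequality then sums over the blocks.\<close>
lemma weighted_Holder:
  assumes conj: "1 \<le> r" "1 \<le> r'" "1 / r + 1 / r' = 1"
    and A: "0 \<le> A" "weighted_norm I \<mu> \<theta> r b \<le> ennreal A"
    and B: "0 \<le> B" "weighted_norm I \<mu> \<theta> r' (\<lambda>i. y i * \<mu> i powr \<theta>) \<le> ennreal B"
    and F: "finite F" "F \<subseteq> I"
  shows "\<bar>\<Sum>i\<in>F. b i * y i\<bar> \<le> A * B"
proof -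
  let ?c = "block_norm I \<mu> \<theta> b" and ?d = "block_norm I \<mu> \<theta> (\<lambda>i. y i * \<mu> i powr \<theta>)"
  have block: "(\<Sum>i\<in>F \<inter> dyadic_block I \<mu> j. \<bar>b i * y i\<bar>) \<le> ?c j * ?d j" for j
  proof -
    let ?D = "dyadic_block I \<mu> j"
    let ?u = "\<lambda>i. b i * \<mu> i powr (- \<theta> / 2)" and ?v = "\<lambda>i. y i * \<mu> i powr (\<theta> / 2)"
    have powr_half: "(\<mu> i powr (s / 2))\<^sup>2 = \<mu> i powr s" for i s
      by (simp add: power2_eq_square flip: powr_add)
    have "(\<Sum>i\<in>F \<inter> ?D. \<bar>b i * y i\<bar>) \<le> (\<Sum>i\<in>?D. \<bar>b i * y i\<bar>)"
      by (rule sum_mono2) (auto simp: finite_block)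
    also have "\<dots> = (\<Sum>i\<in>?D. \<bar>?u i\<bar> * \<bar>?v i\<bar>)"
    proof (rule sum.cong)
      fix i assume "i \<in> ?D"
      then have "\<mu> i > 0" using weight_pos by (simp add: dyadic_block_def)
      then have "\<mu> i powr (- \<theta> / 2) * \<mu> i powr (\<theta> / 2) = 1" by (simp flip: powr_add)
      then show "\<bar>b i * y i\<bar> = \<bar>?u i\<bar> * \<bar>?v i\<bar>"
        by (simp add: abs_mult)
    qed simp
    also have "\<dots> \<le> L2_set ?u ?D * L2_set ?v ?D" by (rule L2_set_mult_ineq)
    also have "L2_set ?u ?D = ?c j"
      using powr_half[of _ "- \<theta>"] by (simp add: L2_set_def block_norm_def power_mult_distrib)
    also have "L2_set ?v ?D = ?d j"
      using powr_half[of _ \<theta>] by (simp add: L2_set_def block_norm_dual power_mult_distrib)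
    finally show ?thesis .
  qed
  have "\<bar>\<Sum>i\<in>F. b i * y i\<bar> \<le> (\<Sum>i\<in>F. \<bar>b i * y i\<bar>)" by (rule sum_abs)
  also have "\<dots> = (\<Sum>j\<in>level ` F. \<Sum>i\<in>F \<inter> dyadic_block I \<mu> j. \<bar>b i * y i\<bar>)"
    using F by (rule sum_by_levels)
  also have "\<dots> \<le> (\<Sum>j\<in>level ` F. \<bar>?c j * ?d j\<bar>)"
    using block by (intro sum_mono) (meson abs_ge_self order_trans)
  also have "\<dots> \<le> A * B"
    using A B F by (intro lq_norm_Holder[OF conj]) (auto simp: weighted_norm_def)
  finally show ?thesis .
qed

text \<open>A test sequence \<open>a\<close> on the level of blocks is lifted to coefficients \<open>b\<close> with block norms at most \<open>a\<close> for which
\<open>\<Sum>i. b i * y i\<close> is the pairing of \<open>a\<close> with the block norms of \<open>y\<close>.\<close>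
lemma weighted_norm_le_by_duality:
  assumes conj: "1 \<le> r" "1 \<le> r'" "1 / r + 1 / r' = 1" and K: "0 \<le> K"
    and test: "\<And>F b. \<lbrakk>finite F; F \<subseteq> I; \<And>i. i \<notin> F \<Longrightarrow> b i = 0; weighted_norm I \<mu> \<theta> r b \<le> 1\<rbrakk>
      \<Longrightarrow> \<bar>\<Sum>i\<in>F. b i * y i\<bar> \<le> K"
  shows "weighted_norm I \<mu> \<theta> r' (\<lambda>i. y i * \<mu> i powr \<theta>) \<le> ennreal K"
  unfolding weighted_norm_def
proof (rule lq_norm_le_by_duality[OF conj K])
  let ?d = "block_norm I \<mu> \<theta> (\<lambda>i. y i * \<mu> i powr \<theta>)"
  fix J and a :: "int \<Rightarrow> real"
  assume J: "finite J" and a: "\<And>j. 0 \<le> a j" "\<And>j. j \<notin> J \<Longrightarrow> a j = 0" and "lq_norm r a \<le> 1"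
  define F where "F = (\<Union>j\<in>J. dyadic_block I \<mu> j)"
  have F: "finite F" "F \<subseteq> I"
    using J finite_block by (auto simp: F_def dyadic_block_def)
  (* On the block j this is the vector that realises the Cauchy-Schwarz inequality against y;
     where the block norm of y vanishes, division by zero makes it 0. *)
  define b where "b i = (if i \<in> F then a (level i) * y i * \<mu> i powr \<theta> / ?d (level i) else 0)" for i
  have squares: "(\<Sum>i\<in>dyadic_block I \<mu> j. (y i)\<^sup>2 * \<mu> i powr \<theta>) = (?d j)\<^sup>2" for j
    by (simp add: block_norm_dual sum_nonneg)
  have b_block: "b i = a j * (y i * \<mu> i powr \<theta>) / ?d j" if "i \<in> dyadic_block I \<mu> j" for i j
  proof (cases "j \<in> J")
    case True
    then show ?thesis using that by (auto simp: b_def F_def mem_dyadic_block_iff)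
  next
    case False
    then show ?thesis using that a by (auto simp: b_def F_def mem_dyadic_block_iff)
  qed
  have "\<bar>block_norm I \<mu> \<theta> b j\<bar> \<le> \<bar>a j\<bar>" for j
  proof -
    let ?w = "\<lambda>i. y i * \<mu> i powr \<theta>"
    have "(\<Sum>i\<in>dyadic_block I \<mu> j. (b i)\<^sup>2 * \<mu> i powr (- \<theta>))
        = (\<Sum>i\<in>dyadic_block I \<mu> j. (a j / ?d j)\<^sup>2 * ((?w i)\<^sup>2 * \<mu> i powr (- \<theta>)))"
      by (intro sum.cong) (auto simp: b_block power_mult_distrib power_divide)
    also have "\<dots> = (a j / ?d j)\<^sup>2 * (?d j)\<^sup>2"
      by (simp add: sum_distrib_left[symmetric] block_norm_def[of _ _ _ ?w] sum_nonneg)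
    also have "\<dots> \<le> (a j)\<^sup>2" by (cases "?d j = 0") (auto simp: power_divide)
    finally show ?thesis
      using a(1)[of j] by (simp add: block_norm_nonneg) (simp add: block_norm_def real_le_lsqrt)
  qed
  then have "weighted_norm I \<mu> \<theta> r b \<le> ennreal 1"
    unfolding weighted_norm_def
    using lq_norm_le_mono[OF conj(1), of 1 a] \<open>lq_norm r a \<le> 1\<close> by simp
  moreover have "i \<notin> F \<Longrightarrow> b i = 0" for i by (simp add: b_def)
  ultimately have "\<bar>\<Sum>i\<in>F. b i * y i\<bar> \<le> K"
    using F by (intro test) (auto simp only: ennreal_1)
  also have "(\<Sum>i\<in>F. b i * y i) = (\<Sum>j\<in>J. \<Sum>i\<in>dyadic_block I \<mu> j. b i * y i)"
    unfolding F_def using J finite_block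
    by (intro sum.UNION_disjoint) (auto simp: mem_dyadic_block_iff)
  also have "\<dots> = (\<Sum>j\<in>J. a j * \<bar>?d j\<bar>)"
  proof (rule sum.cong)
    fix j
    have "(\<Sum>i\<in>dyadic_block I \<mu> j. b i * y i)
        = (\<Sum>i\<in>dyadic_block I \<mu> j. a j / ?d j * ((y i)\<^sup>2 * \<mu> i powr \<theta>))"
      by (intro sum.cong) (auto simp: b_block power2_eq_square)
    also have "\<dots> = a j / ?d j * (?d j)\<^sup>2"
      by (simp only: sum_distrib_left[symmetric] squares)
    also have "\<dots> = a j * \<bar>?d j\<bar>"
      using block_norm_nonneg by (simp add: power2_eq_square)
    finally show "(\<Sum>i\<in>dyadic_block I \<mu> j. b i * y i) = a j * \<bar>?d j\<bar>" .
  qed simp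
  finally show "(\<Sum>j\<in>J. a j * \<bar>?d j\<bar>) \<le> K" by simp
qed

definition rational_coeffs :: "rat list \<Rightarrow> nat \<Rightarrow> real" where
  "rational_coeffs l i = (if i \<in> I \<and> i < length l then real_of_rat (l ! i) else 0)"

text \<open>Countably many tests decide the norm. This is what allows the exceptional null sets of the individual tests to
be united into one. A real test vector is approximated by rational ones that are no larger in any
coordinate: these stay in the unit ball by monotonicity of the norm.\<close>
lemma weighted_norm_le_by_rational_duality:
  assumes conj: "1 \<le> r" "1 \<le> r'" "1 / r + 1 / r' = 1" and K: "0 \<le> K"
    and test: "\<And>l. weighted_norm I \<mu> \<theta> r (rational_coeffs l) \<le> 1
      \<Longrightarrow> \<bar>\<Sum>i\<in>I \<inter> {..<length l}. rational_coeffs l i * y i\<bar> \<le> K"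
  shows "weighted_norm I \<mu> \<theta> r' (\<lambda>i. y i * \<mu> i powr \<theta>) \<le> ennreal K"
proof (rule weighted_norm_le_by_duality[OF conj K])
  fix F b
  assume F: "finite F" "F \<subseteq> I" and b: "\<And>i. i \<notin> F \<Longrightarrow> b i = (0::real)"
    and norm: "weighted_norm I \<mu> \<theta> r b \<le> 1"
  obtain N where N: "F \<subseteq> {..<N}" using F(1) finite_nat_bounded by blast
  show "\<bar>\<Sum>i\<in>F. b i * y i\<bar> \<le> K"
  proof (rule field_le_epsilon)
    fix \<epsilon> :: real assume "\<epsilon> > 0"
    \<comment> \<open>The summand 1 keeps the divisor positive when \<open>y\<close> vanishes on \<open>F\<close>.\<close>
    define Y where "Y = 1 + (\<Sum>i\<in>F. \<bar>y i\<bar>)"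
    have Y: "Y > 0" unfolding Y_def by (simp add: add_pos_nonneg sum_nonneg)
    define \<delta> where "\<delta> = \<epsilon> / Y"
    have \<delta>: "\<delta> > 0" using \<open>\<epsilon> > 0\<close> Y by (simp add: \<delta>_def)
    have "\<exists>q. \<bar>real_of_rat q\<bar> \<le> \<bar>x\<bar> \<and> \<bar>x - real_of_rat q\<bar> \<le> \<delta>" for x :: real
    proof (cases "x = 0")
      case True
      then show ?thesis using \<delta> by (intro exI[of _ 0]) auto
    next
      case False
      consider "x > 0" | "x < 0" using False by linarith
      then show ?thesis
      proof cases
        case 1
        then obtain q where "max 0 (x - \<delta>) < real_of_rat q" "real_of_rat q < x"
          using of_rat_dense[of "max 0 (x - \<delta>)" x] \<delta> by auto
        then show ?thesis using 1 by (intro exI[of _ q]) auto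
      next
        case 2
        then obtain q where "x < real_of_rat q" "real_of_rat q < min 0 (x + \<delta>)"
          using of_rat_dense[of x "min 0 (x + \<delta>)"] \<delta> by auto
        then show ?thesis using 2 by (intro exI[of _ q]) (auto simp del: of_rat_minus simp: abs_if)
      qed
    qed
    then obtain q where q: "\<And>x. \<bar>real_of_rat (q x)\<bar> \<le> \<bar>x\<bar>" "\<And>x. \<bar>x - real_of_rat (q x)\<bar> \<le> \<delta>"
      by metis
    define l where "l = map (\<lambda>i. q (b i)) [0..<N]"
    have coeff: "rational_coeffs l i = real_of_rat (q (b i))" if "i \<in> I" "i < N" for i
      using that by (simp add: rational_coeffs_def l_def)
    have small: "\<bar>rational_coeffs l i\<bar> \<le> \<bar>b i\<bar>" for i
      using q(1)[of "b i"] by (auto simp: rational_coeffs_def l_def)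
    have zero: "rational_coeffs l i = 0" if "i \<notin> F" for i
      using small[of i] b[OF that] by simp
    have "weighted_norm I \<mu> \<theta> r (rational_coeffs l) \<le> ennreal 1"
      by (rule weighted_norm_le_mono[OF conj(1), of 1 \<theta> b]) (use small norm in simp_all)
    then have "\<bar>\<Sum>i\<in>I \<inter> {..<length l}. rational_coeffs l i * y i\<bar> \<le> K"
      by (intro test) simp
    also have "(\<Sum>i\<in>I \<inter> {..<length l}. rational_coeffs l i * y i) = (\<Sum>i\<in>F. rational_coeffs l i * y i)"
      using F N zero by (intro sum.mono_neutral_right) (auto simp: l_def)
    finally have rational: "\<bar>\<Sum>i\<in>F. rational_coeffs l i * y i\<bar> \<le> K" .
    have "\<bar>(\<Sum>i\<in>F. b i * y i) - (\<Sum>i\<in>F. rational_coeffs l i * y i)\<bar>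
        = \<bar>\<Sum>i\<in>F. (b i - rational_coeffs l i) * y i\<bar>"
      by (simp add: sum_subtractf left_diff_distrib)
    also have "\<dots> \<le> (\<Sum>i\<in>F. \<bar>(b i - rational_coeffs l i) * y i\<bar>)" by (rule sum_abs)
    also have "\<dots> \<le> (\<Sum>i\<in>F. \<delta> * \<bar>y i\<bar>)"
      unfolding abs_mult
    proof (intro sum_mono mult_right_mono)
      fix i assume "i \<in> F"
      then have "rational_coeffs l i = real_of_rat (q (b i))" using F N by (intro coeff) auto
      then show "\<bar>b i - rational_coeffs l i\<bar> \<le> \<delta>" using q(2)[of "b i"] by simp
    qed simp
    also have "\<dots> \<le> \<delta> * Y" using \<delta> by (simp add: Y_def sum_distrib_left[symmetric])
    also have "\<dots> = \<epsilon>" using Y by (simp add: \<delta>_def)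
    finally show "\<bar>\<Sum>i\<in>F. b i * y i\<bar> \<le> K + \<epsilon>" using rational by linarith
  qed
qed

lemma borel_measurable_weighted_norm:
  assumes "\<And>i. i \<in> I \<Longrightarrow> (\<lambda>x. f x i) \<in> borel_measurable M"
  shows "(\<lambda>x. weighted_norm I \<mu> \<theta> q (f x)) \<in> borel_measurable M"
  unfolding weighted_norm_def
proof (rule borel_measurable_lq_norm)
  fix j
  have "(\<lambda>x. (f x i)\<^sup>2 * \<mu> i powr (- \<theta>)) \<in> borel_measurable M" if "i \<in> dyadic_block I \<mu> j" for i
    using assms[of i] that by (auto simp: dyadic_block_def)
  then show "(\<lambda>x. block_norm I \<mu> \<theta> (f x) j) \<in> borel_measurable M"
    unfolding block_norm_def
    by (intro measurable_compose[OF _ borel_measurable_sqrt] borel_measurable_sum)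
qed

end

section \<open>Square integrable classes and their series\<close>

lemma ae_class_nonempty: "f \<in> borel_measurable M \<Longrightarrow> f \<in> ae_class M f"
  by (simp add: ae_class_def)

lemma ae_rep_mem: "F \<noteq> {} \<Longrightarrow> ae_rep F \<in> F"
  by (simp add: ae_rep_def some_in_eq)

lemma ae_rep_ae_class:
  assumes "f \<in> borel_measurable M"
  shows "ae_rep (ae_class M f) \<in> borel_measurable M" "AE x in M. ae_rep (ae_class M f) x = f x"
  using ae_rep_mem[of "ae_class M f"] ae_class_nonempty[OF assms] by (auto simp: ae_class_def)

lemma ae_class_cong:
  assumes "AE x in M. f x = g x"
  shows "ae_class M f = ae_class M g"
  unfolding ae_class_def
proof (intro Collect_cong conj_cong refl iffI)
  fix h assume "AE x in M. h x = f x" then show "AE x in M. h x = g x" using assms by eventually_elim simp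
next
  fix h assume "AE x in M. h x = g x" then show "AE x in M. h x = f x" using assms by eventually_elim simp
qed

lemma ae_class_eq_iff:
  assumes "f \<in> borel_measurable M"
  shows "ae_class M f = ae_class M g \<longleftrightarrow> (AE x in M. f x = g x)"
  using ae_class_nonempty[OF assms] ae_class_cong[where M = M and f = f and g = g]
  by (auto simp: ae_class_def)

lemma class_diff_ae_class:
  assumes "f \<in> borel_measurable M" "g \<in> borel_measurable M"
  shows "class_diff M (ae_class M f) (ae_class M g) = ae_class M (\<lambda>x. f x - g x)"
  unfolding class_diff_def
proof (rule ae_class_cong)
  show "AE x in M. ae_rep (ae_class M f) x - ae_rep (ae_class M g) x = f x - g x"
    using ae_rep_ae_class(2)[OF assms(1)] ae_rep_ae_class(2)[OF assms(2)] by eventually_elim simp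
qed

lemma class_scale_ae_class:
  assumes "f \<in> borel_measurable M"
  shows "class_scale M c (ae_class M f) = ae_class M (\<lambda>x. c * f x)"
  unfolding class_scale_def
proof (rule ae_class_cong)
  show "AE x in M. c * ae_rep (ae_class M f) x = c * f x"
    using ae_rep_ae_class(2)[OF assms] by eventually_elim simp
qed

lemma class_lincomb_ae_class:
  assumes "finite A" "\<And>i. i \<in> A \<Longrightarrow> f i \<in> borel_measurable M"
  shows "class_lincomb M A c (\<lambda>i. ae_class M (f i)) = ae_class M (\<lambda>x. \<Sum>i\<in>A. c i * f i x)"
  unfolding class_lincomb_def
proof (rule ae_class_cong)
  have "AE x in M. \<forall>i\<in>A. ae_rep (ae_class M (f i)) x = f i x"
    using assms by (intro AE_finite_allI ae_rep_ae_class(2))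
  then show "AE x in M. (\<Sum>i\<in>A. c i * ae_rep (ae_class M (f i)) x) = (\<Sum>i\<in>A. c i * f i x)"
    by eventually_elim simp
qed

lemma square_integrable_measurable: "f \<in> square_integrable M \<Longrightarrow> f \<in> borel_measurable M"
  by (simp add: square_integrable_def)

lemma square_integrable_mult:
  assumes "f \<in> square_integrable M" "g \<in> square_integrable M"
  shows "integrable M (\<lambda>x. f x * g x)"
proof (rule Bochner_Integration.integrable_bound)
  show "integrable M (\<lambda>x. (f x)\<^sup>2 + (g x)\<^sup>2)" using assms by (simp add: square_integrable_def)
  show "(\<lambda>x. f x * g x) \<in> borel_measurable M" using assms by (auto simp: square_integrable_def)
  have "\<bar>f x * g x\<bar> \<le> (f x)\<^sup>2 + (g x)\<^sup>2" for x
  proof -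
    have "2 * \<bar>f x * g x\<bar> \<le> (f x)\<^sup>2 + (g x)\<^sup>2"
      using sum_squares_bound[of "\<bar>f x\<bar>" "\<bar>g x\<bar>"] by (simp add: abs_mult)
    then show ?thesis by linarith
  qed
  then show "AE x in M. norm (f x * g x) \<le> norm ((f x)\<^sup>2 + (g x)\<^sup>2)" by simp
qed

lemma square_integrable_add_mult:
  assumes "f \<in> square_integrable M" "g \<in> square_integrable M"
  shows "(\<lambda>x. f x + c * g x) \<in> square_integrable M"
proof -
  have "integrable M (\<lambda>x. (f x)\<^sup>2 + 2 * c * (f x * g x) + c\<^sup>2 * (g x)\<^sup>2)"
    using assms square_integrable_mult[OF assms] by (simp add: square_integrable_def)
  moreover have "(\<lambda>x. (f x)\<^sup>2 + 2 * c * (f x * g x) + c\<^sup>2 * (g x)\<^sup>2) = (\<lambda>x. (f x + c * g x)\<^sup>2)"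
    by (simp add: power2_eq_square algebra_simps)
  ultimately show ?thesis using assms by (auto simp: square_integrable_def)
qed

lemma square_integrable_zero: "(\<lambda>x. 0) \<in> square_integrable M"
  by (simp add: square_integrable_def)

lemma square_integrable_diff:
  "\<lbrakk>f \<in> square_integrable M; g \<in> square_integrable M\<rbrakk> \<Longrightarrow> (\<lambda>x. f x - g x) \<in> square_integrable M"
  using square_integrable_add_mult[of f M g "-1"] by simp

lemma square_integrable_sum:
  assumes "finite A" "\<And>i. i \<in> A \<Longrightarrow> f i \<in> square_integrable M"
  shows "(\<lambda>x. \<Sum>i\<in>A. c i * f i x) \<in> square_integrable M"
  using assms
proof (induction A rule: finite_induct)
  case (insert a A)
  then show ?case
    using square_integrable_add_mult[of "\<lambda>x. \<Sum>i\<in>A. c i * f i x" M "f a" "c a"]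
    by (simp add: add.commute)
qed (simp add: square_integrable_zero)

lemma L2_inner_ae_class:
  assumes "f \<in> borel_measurable M" "g \<in> borel_measurable M"
  shows "L2_inner M (ae_class M f) (ae_class M g) = (LINT x|M. f x * g x)"
  unfolding L2_inner_def
proof (rule integral_cong_AE)
  show "AE x in M. ae_rep (ae_class M f) x * ae_rep (ae_class M g) x = f x * g x"
    using ae_rep_ae_class(2)[OF assms(1)] ae_rep_ae_class(2)[OF assms(2)] by eventually_elim simp
qed (use assms ae_rep_ae_class(1) in \<open>auto intro: borel_measurable_times\<close>)

text \<open>The Cauchy-Schwarz inequality for a semidefinite form, stated on the level of its three values; together
with the triangle inequality below it serves both \<open>L2\<close> and the space \<open>H\<close>, and it also bounds the derivative of a
quadratic functional near its infimum.\<close>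
lemma quadratic_nonneg_imp_discriminant:
  fixes a b c :: real
  assumes "\<And>t. 0 \<le> a + 2 * t * b + t\<^sup>2 * c" "0 \<le> c"
  shows "b\<^sup>2 \<le> a * c"
proof (cases "c = 0")
  case True
  have "b = 0"
  proof (rule ccontr)
    assume "b \<noteq> 0"
    then show False using assms(1)[of "- (a + 1) / (2 * b)"] True by (simp add: field_simps)
  qed
  then show ?thesis using True by simp
next
  case False
  then have "0 \<le> (a - b\<^sup>2 / c) * c"
    using assms(1)[of "- b / c"] assms(2)
    by (intro mult_nonneg_nonneg) (simp_all add: power2_eq_square)
  then show ?thesis using False by (simp add: left_diff_distrib)
qed

lemma sqrt_add_le:
  fixes a b c :: real
  assumes "b\<^sup>2 \<le> a * c" "0 \<le> a" "0 \<le> c"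
  shows "sqrt (a + 2 * b + c) \<le> sqrt a + sqrt c"
proof (rule real_le_lsqrt)
  have "b \<le> sqrt (a * c)" using assms(1) by (intro real_le_rsqrt)
  then show "a + 2 * b + c \<le> (sqrt a + sqrt c)\<^sup>2"
    using assms by (simp add: power2_sum real_sqrt_mult)
qed (use assms in auto)

lemma L2_Cauchy_Schwarz:
  assumes "f \<in> square_integrable M" "g \<in> square_integrable M"
  shows "(LINT x|M. f x * g x)\<^sup>2 \<le> (LINT x|M. (f x)\<^sup>2) * (LINT x|M. (g x)\<^sup>2)"
proof (rule quadratic_nonneg_imp_discriminant)
  fix t :: real
  have "0 \<le> (LINT x|M. (f x + t * g x)\<^sup>2)" by (rule integral_nonneg_AE) simp
  also have "(\<lambda>x. (f x + t * g x)\<^sup>2) = (\<lambda>x. (f x)\<^sup>2 + 2 * t * (f x * g x) + t\<^sup>2 * (g x)\<^sup>2)"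
    by (simp add: power2_eq_square algebra_simps)
  also have "(LINT x|M. (f x)\<^sup>2 + 2 * t * (f x * g x) + t\<^sup>2 * (g x)\<^sup>2)
      = (LINT x|M. (f x)\<^sup>2) + 2 * t * (LINT x|M. f x * g x) + t\<^sup>2 * (LINT x|M. (g x)\<^sup>2)"
    using assms square_integrable_mult[OF assms] by (simp add: square_integrable_def)
  finally show "0 \<le> (LINT x|M. (f x)\<^sup>2) + 2 * t * (LINT x|M. f x * g x) + t\<^sup>2 * (LINT x|M. (g x)\<^sup>2)" .
qed (rule integral_nonneg_AE, simp)

definition L2_dist :: "'a measure \<Rightarrow> ('a \<Rightarrow> real) set \<Rightarrow> ('a \<Rightarrow> real) set \<Rightarrow> real" where
  "L2_dist M F G = L2_norm M (class_diff M F G)"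

lemma L2_dist_ae_class:
  assumes "f \<in> borel_measurable M" "g \<in> borel_measurable M"
  shows "L2_dist M (ae_class M f) (ae_class M g) = sqrt (LINT x|M. (f x - g x)\<^sup>2)"
  using assms
  by (simp add: L2_dist_def L2_norm_def class_diff_ae_class L2_inner_ae_class power2_eq_square)

lemma Metric_space_L2: "Metric_space (L2 M) (L2_dist M)"
proof
  fix F G :: "('a \<Rightarrow> real) set"
  show "0 \<le> L2_dist M F G"
    by (simp add: L2_dist_def L2_norm_def L2_inner_def integral_nonneg_AE)
  (* For arbitrary sets F and G the difference may be empty; then so is the opposite one. *)
  show "L2_dist M F G = L2_dist M G F"
  proof (cases "class_diff M F G = {}")
    case True
    have "class_diff M G F = {}"
    proof (rule ccontr)
      assume "class_diff M G F \<noteq> {}"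
      then obtain h where "h \<in> borel_measurable M" "AE x in M. h x = ae_rep G x - ae_rep F x"
        by (auto simp: class_diff_def ae_class_def)
      then have "(\<lambda>x. - h x) \<in> class_diff M F G"
        by (auto simp: class_diff_def ae_class_def)
      then show False using True by simp
    qed
    then show ?thesis using True by (simp add: L2_dist_def)
  next
    case False
    then obtain h where h: "h \<in> borel_measurable M" "AE x in M. h x = ae_rep F x - ae_rep G x"
      by (auto simp: class_diff_def ae_class_def)
    have "class_diff M F G = ae_class M h"
      unfolding class_diff_def using h by (intro ae_class_cong) auto
    moreover have "class_diff M G F = ae_class M (\<lambda>x. - h x)"
      unfolding class_diff_def using h by (intro ae_class_cong) auto
    ultimately show ?thesis
      using h by (simp add: L2_dist_def L2_norm_def L2_inner_ae_class)
  qed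
next
  fix F G assume "F \<in> L2 M" "G \<in> L2 M"
  then obtain f g where f: "f \<in> square_integrable M" "F = ae_class M f"
    and g: "g \<in> square_integrable M" "G = ae_class M g"
    by (auto simp: L2_def)
  note [measurable] = f(1)[THEN square_integrable_measurable] g(1)[THEN square_integrable_measurable]
  have "L2_dist M F G = 0 \<longleftrightarrow> (LINT x|M. (f x - g x)\<^sup>2) = 0"
    by (simp add: f g L2_dist_ae_class)
  also have "\<dots> \<longleftrightarrow> (AE x in M. (f x - g x)\<^sup>2 = 0)"
    using square_integrable_diff[OF f(1) g(1)]
    by (intro integral_nonneg_eq_0_iff_AE) (auto simp: square_integrable_def)
  also have "\<dots> \<longleftrightarrow> F = G"
    by (simp add: f g ae_class_eq_iff)
  finally show "L2_dist M F G = 0 \<longleftrightarrow> F = G" .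
next
  fix F G K assume "F \<in> L2 M" "G \<in> L2 M" "K \<in> L2 M"
  then obtain f g h where f: "f \<in> square_integrable M" "F = ae_class M f"
    and g: "g \<in> square_integrable M" "G = ae_class M g"
    and h: "h \<in> square_integrable M" "K = ae_class M h"
    by (auto simp: L2_def)
  note fg = square_integrable_diff[OF f(1) g(1)] and gh = square_integrable_diff[OF g(1) h(1)]
  have "(\<lambda>x. (f x - h x)\<^sup>2) = (\<lambda>x. (f x - g x)\<^sup>2 + 2 * ((f x - g x) * (g x - h x)) + (g x - h x)\<^sup>2)"
    by (simp add: power2_eq_square algebra_simps)
  then have "(LINT x|M. (f x - h x)\<^sup>2) = (LINT x|M. (f x - g x)\<^sup>2)
      + 2 * (LINT x|M. (f x - g x) * (g x - h x)) + (LINT x|M. (g x - h x)\<^sup>2)"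
    using fg gh square_integrable_mult[OF fg gh] by (simp add: square_integrable_def)
  then show "L2_dist M F K \<le> L2_dist M F G + L2_dist M G K"
    using sqrt_add_le[OF L2_Cauchy_Schwarz[OF fg gh]] f g h
    by (simp add: L2_dist_ae_class square_integrable_measurable integral_nonneg_AE)
qed

lemma L2_topology_eq: "L2_topology M = Metric_space.mtopology (L2 M) (L2_dist M)"
  unfolding L2_topology_def L2_dist_def ..

lemma L2_series_iff:
  assumes e: "\<And>i. i \<in> I \<Longrightarrow> e i \<in> square_integrable M" and f: "f \<in> square_integrable M"
  shows "L2_series M I e b (ae_class M f)
    \<longleftrightarrow> (\<lambda>n. LINT x|M. ((\<Sum>i\<in>I \<inter> {..n}. b i * e i x) - f x)\<^sup>2) \<longlonglongrightarrow> 0"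
proof -
  interpret Metric_space "L2 M" "L2_dist M" by (rule Metric_space_L2)
  define S where "S n = (\<lambda>x. \<Sum>i\<in>I \<inter> {..n}. b i * e i x)" for n
  have S: "S n \<in> square_integrable M" for n
    unfolding S_def using e by (intro square_integrable_sum) auto
  have lincomb: "class_lincomb M (I \<inter> {..n}) b (\<lambda>i. ae_class M (e i)) = ae_class M (S n)" for n
    unfolding S_def using e by (intro class_lincomb_ae_class) (auto intro: square_integrable_measurable)
  have "L2_series M I e b (ae_class M f)
      \<longleftrightarrow> (\<lambda>n. L2_dist M (ae_class M (S n)) (ae_class M f)) \<longlonglongrightarrow> 0"
    unfolding L2_series_def L2_topology_eq lincomb limitin_metric_dist_null
    using S f by (auto simp: L2_def)
  also have "\<dots> \<longleftrightarrow> (\<lambda>n. sqrt (LINT x|M. (S n x - f x)\<^sup>2)) \<longlonglongrightarrow> 0"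
    using S f by (simp add: L2_dist_ae_class square_integrable_measurable)
  also have "\<dots> \<longleftrightarrow> (\<lambda>n. LINT x|M. (S n x - f x)\<^sup>2) \<longlonglongrightarrow> 0"
  proof
    assume "(\<lambda>n. sqrt (LINT x|M. (S n x - f x)\<^sup>2)) \<longlonglongrightarrow> 0"
    from tendsto_power[OF this, of 2] show "(\<lambda>n. LINT x|M. (S n x - f x)\<^sup>2) \<longlonglongrightarrow> 0"
      by (simp add: integral_nonneg_AE)
  next
    assume "(\<lambda>n. LINT x|M. (S n x - f x)\<^sup>2) \<longlonglongrightarrow> 0"
    from tendsto_real_sqrt[OF this] show "(\<lambda>n. sqrt (LINT x|M. (S n x - f x)\<^sup>2)) \<longlonglongrightarrow> 0"
      by simp
  qed
  finally show ?thesis by (simp only: S_def)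
qed

lemma L2_series_in_L2: "L2_series M I e b F \<Longrightarrow> F \<in> L2 M"
proof -
  interpret Metric_space "L2 M" "L2_dist M" by (rule Metric_space_L2)
  show "L2_series M I e b F \<Longrightarrow> F \<in> L2 M"
    unfolding L2_series_def L2_topology_eq limitin_metric_dist_null by simp
qed

text \<open>Pairing with \<open>e i\<close> is continuous in \<open>L2\<close> and has the value \<open>b i\<close> on all partial sums from the index \<open>i\<close> on.\<close>
lemma L2_series_coefficient:
  assumes e: "\<And>i. i \<in> I \<Longrightarrow> e i \<in> square_integrable M"
    and orthonormal: "\<And>i j. \<lbrakk>i \<in> I; j \<in> I\<rbrakk> \<Longrightarrow> (LINT x|M. e i x * e j x) = (if i = j then 1 else 0)"
    and f: "f \<in> square_integrable M" and series: "L2_series M I e b (ae_class M f)" and i: "i \<in> I"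
  shows "b i = (LINT x|M. f x * e i x)"
proof -
  define S where "S n = (\<lambda>x. \<Sum>j\<in>I \<inter> {..n}. b j * e j x)" for n
  have S: "S n \<in> square_integrable M" for n
    unfolding S_def using e by (intro square_integrable_sum) auto
  have lim: "(\<lambda>n. LINT x|M. (S n x - f x)\<^sup>2) \<longlonglongrightarrow> 0"
    using L2_series_iff[OF e f] series by (simp add: S_def)
  have inner: "(LINT x|M. S n x * e i x) = b i" if "n \<ge> i" for n
  proof -
    have "(LINT x|M. S n x * e i x) = (LINT x|M. (\<Sum>j\<in>I \<inter> {..n}. b j * (e j x * e i x)))"
      by (simp add: S_def sum_distrib_right mult.assoc)
    also have "\<dots> = (\<Sum>j\<in>I \<inter> {..n}. b j * (LINT x|M. e j x * e i x))"
      using e i by (subst Bochner_Integration.integral_sum) (auto intro: square_integrable_mult)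
    also have "\<dots> = (\<Sum>j\<in>I \<inter> {..n}. if j = i then b j else 0)"
      using i orthonormal by (intro sum.cong) auto
    also have "\<dots> = b i" using i that by simp
    finally show ?thesis .
  qed
  have bound: "(b i - (LINT x|M. f x * e i x))\<^sup>2 \<le> (LINT x|M. (S n x - f x)\<^sup>2)" if "n \<ge> i" for n
  proof -
    have "b i - (LINT x|M. f x * e i x) = (LINT x|M. (S n x - f x) * e i x)"
      using square_integrable_mult[OF S e[OF i], of n] square_integrable_mult[OF f e[OF i]] inner[OF that]
      by (simp add: left_diff_distrib)
    then show ?thesis
      using L2_Cauchy_Schwarz[OF square_integrable_diff[OF S f] e[OF i], of n] orthonormal[OF i i]
      by (simp add: power2_eq_square)
  qed
  have "(b i - (LINT x|M. f x * e i x))\<^sup>2 \<le> 0"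
    by (rule LIMSEQ_le_const[OF lim]) (use bound in blast)
  then show ?thesis by simp
qed

lemma L2_series_diff:
  assumes e: "\<And>i. i \<in> I \<Longrightarrow> e i \<in> square_integrable M"
    and F: "L2_series M I e b F" and G: "L2_series M I e c G"
  shows "L2_series M I e (\<lambda>i. b i - c i) (class_diff M F G)"
proof -
  obtain f g where f: "f \<in> square_integrable M" "F = ae_class M f"
    and g: "g \<in> square_integrable M" "G = ae_class M g"
    using L2_series_in_L2[OF F] L2_series_in_L2[OF G] by (auto simp: L2_def)
  define S where "S b n = (\<lambda>x. \<Sum>j\<in>I \<inter> {..n}. b j * e j x)" for b n
  have S: "S b n \<in> square_integrable M" for b n
    unfolding S_def using e by (intro square_integrable_sum) auto
  have limF: "(\<lambda>n. LINT x|M. (S b n x - f x)\<^sup>2) \<longlonglongrightarrow> 0"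
    using L2_series_iff[OF e f(1)] F f by (simp add: S_def)
  have limG: "(\<lambda>n. LINT x|M. (S c n x - g x)\<^sup>2) \<longlonglongrightarrow> 0"
    using L2_series_iff[OF e g(1)] G g by (simp add: S_def)
  have diff: "class_diff M F G = ae_class M (\<lambda>x. f x - g x)"
    using f g by (simp add: class_diff_ae_class square_integrable_measurable)
  have "(\<lambda>n. LINT x|M. (S (\<lambda>i. b i - c i) n x - (f x - g x))\<^sup>2) \<longlonglongrightarrow> 0"
  proof (rule tendsto_sandwich[where f = "\<lambda>_. 0"])
    show "(\<lambda>n. 2 * (LINT x|M. (S b n x - f x)\<^sup>2) + 2 * (LINT x|M. (S c n x - g x)\<^sup>2)) \<longlonglongrightarrow> 0"
      using tendsto_add[OF tendsto_mult_left[OF limF, of 2] tendsto_mult_left[OF limG, of 2]] by simp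
    show "\<forall>\<^sub>F n in sequentially. (LINT x|M. (S (\<lambda>i. b i - c i) n x - (f x - g x))\<^sup>2)
        \<le> 2 * (LINT x|M. (S b n x - f x)\<^sup>2) + 2 * (LINT x|M. (S c n x - g x)\<^sup>2)"
    proof (rule always_eventually, rule allI)
      fix n
      have int: "integrable M (\<lambda>x. (S b n x - f x)\<^sup>2)" "integrable M (\<lambda>x. (S c n x - g x)\<^sup>2)"
        using square_integrable_diff[OF S f(1)] square_integrable_diff[OF S g(1)]
        by (auto simp: square_integrable_def)
      have "(LINT x|M. (S (\<lambda>i. b i - c i) n x - (f x - g x))\<^sup>2)
          \<le> (LINT x|M. 2 * (S b n x - f x)\<^sup>2 + 2 * (S c n x - g x)\<^sup>2)"
      proof (rule integral_mono)
        show "integrable M (\<lambda>x. (S (\<lambda>i. b i - c i) n x - (f x - g x))\<^sup>2)"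
          using square_integrable_diff[OF S square_integrable_diff[OF f(1) g(1)]]
          by (auto simp: square_integrable_def)
        show "integrable M (\<lambda>x. 2 * (S b n x - f x)\<^sup>2 + 2 * (S c n x - g x)\<^sup>2)" using int by simp
        fix x
        have "S (\<lambda>i. b i - c i) n x - (f x - g x) = (S b n x - f x) - (S c n x - g x)"
          by (simp add: S_def left_diff_distrib sum_subtractf)
        moreover have "(u - v)\<^sup>2 \<le> 2 * u\<^sup>2 + 2 * v\<^sup>2" for u v :: real
          using zero_le_power2[of "u + v"] by (simp add: power2_sum power2_diff)
        ultimately show "(S (\<lambda>i. b i - c i) n x - (f x - g x))\<^sup>2
            \<le> 2 * (S b n x - f x)\<^sup>2 + 2 * (S c n x - g x)\<^sup>2"
          by metis
      qed
      then show "(LINT x|M. (S (\<lambda>i. b i - c i) n x - (f x - g x))\<^sup>2)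
          \<le> 2 * (LINT x|M. (S b n x - f x)\<^sup>2) + 2 * (LINT x|M. (S c n x - g x)\<^sup>2)"
        using int by simp
    qed
  qed (auto simp: integral_nonneg_AE)
  then show ?thesis
    unfolding diff using L2_series_iff[OF e square_integrable_diff[OF f(1) g(1)]]
    by (simp add: S_def)
qed

lemma L2_series_finite_support:
  assumes e: "\<And>i. i \<in> I \<Longrightarrow> e i \<in> square_integrable M" and b: "\<And>i. i \<ge> N \<Longrightarrow> b i = 0"
  shows "L2_series M I e b (ae_class M (\<lambda>x. \<Sum>i\<in>I \<inter> {..<N}. b i * e i x))"
proof -
  let ?f = "\<lambda>x. \<Sum>i\<in>I \<inter> {..<N}. b i * e i x"
  have f: "?f \<in> square_integrable M" using e by (intro square_integrable_sum) auto
  have "(\<Sum>i\<in>I \<inter> {..n}. b i * e i x) = ?f x" if "n \<ge> N" for n x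
    using that b by (intro sum.mono_neutral_right) (auto simp: not_less)
  then have "\<forall>\<^sub>F n in sequentially. (LINT x|M. ((\<Sum>i\<in>I \<inter> {..n}. b i * e i x) - ?f x)\<^sup>2) = 0"
    by (auto simp: eventually_sequentially intro!: exI[of _ N])
  then show ?thesis using L2_series_iff[OF e f] by (simp add: tendsto_eventually)
qed

text \<open>The excess \<open>max 0 (\<bar>f\<bar> - C)\<close> is dominated by \<open>\<bar>S n - f\<bar>\<close> almost everywhere, so its square has integral 0.\<close>
lemma L2_limit_abs_le:
  assumes S: "\<And>n. S n \<in> square_integrable M" and f: "f \<in> square_integrable M"
    and lim: "(\<lambda>n. LINT x|M. (S n x - f x)\<^sup>2) \<longlonglongrightarrow> 0"
    and bound: "AE x in M. \<forall>n. \<bar>S n x\<bar> \<le> C"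
  shows "AE x in M. \<bar>f x\<bar> \<le> C"
proof -
  note [measurable] = f[THEN square_integrable_measurable] S[THEN square_integrable_measurable]
  let ?h = "\<lambda>x. (max 0 (\<bar>f x\<bar> - C))\<^sup>2"
  have le: "AE x in M. ?h x \<le> (S n x - f x)\<^sup>2" for n
    using bound
  proof eventually_elim
    case (elim x)
    then have "\<bar>f x\<bar> - C \<le> \<bar>S n x - f x\<bar>"
      using abs_triangle_ineq2[of "f x" "S n x"] by (auto simp: abs_minus_commute dest!: spec[of _ n])
    then have "\<bar>max 0 (\<bar>f x\<bar> - C)\<bar> \<le> \<bar>S n x - f x\<bar>" by linarith
    then show ?case by (simp only: abs_le_square_iff)
  qed
  have int: "integrable M (\<lambda>x. (S n x - f x)\<^sup>2)" for n
    using square_integrable_diff[OF S f] by (auto simp: square_integrable_def)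
  have h: "integrable M ?h"
    by (rule Bochner_Integration.integrable_bound[OF int[of 0]]) (use le[of 0] in auto)
  have "(LINT x|M. ?h x) \<le> 0"
    by (rule LIMSEQ_le_const[OF lim]) (use integral_mono_AE[OF h int le] in blast)
  then have "(LINT x|M. ?h x) = 0" by (intro antisym) (simp_all add: integral_nonneg_AE)
  then have "AE x in M. ?h x = 0"
    using integral_nonneg_eq_0_iff_AE[OF h] by simp
  then show ?thesis by eventually_elim (simp add: max_def split: if_splits)
qed

lemma esssup_le_iff:
  fixes f :: "'a \<Rightarrow> ennreal"
  assumes "f \<in> borel_measurable M"
  shows "esssup M f \<le> c \<longleftrightarrow> (AE x in M. f x \<le> c)"
proof
  assume "esssup M f \<le> c"
  then show "AE x in M. f x \<le> c"
    using esssup_AE[where M = M and f = f] by (auto elim: eventually_mono)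
qed (rule esssup_I[OF assms])

lemma Linf_norm_ae_class_le_iff:
  assumes "f \<in> borel_measurable M" "0 \<le> t"
  shows "Linf_norm M (ae_class M f) \<le> ennreal t \<longleftrightarrow> (AE x in M. \<bar>f x\<bar> \<le> t)"
proof -
  note rep = ae_rep_ae_class[OF assms(1)]
  have [measurable]: "(\<lambda>x. ennreal \<bar>ae_rep (ae_class M f) x\<bar>) \<in> borel_measurable M"
    using rep(1) by measurable
  have "Linf_norm M (ae_class M f) \<le> ennreal t
      \<longleftrightarrow> (AE x in M. ennreal \<bar>ae_rep (ae_class M f) x\<bar> \<le> ennreal t)"
    unfolding Linf_norm_def by (rule esssup_le_iff) fact
  also have "\<dots> \<longleftrightarrow> (AE x in M. \<bar>f x\<bar> \<le> t)"
  proof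
    assume "AE x in M. ennreal \<bar>ae_rep (ae_class M f) x\<bar> \<le> ennreal t"
    then show "AE x in M. \<bar>f x\<bar> \<le> t" using rep(2) by eventually_elim (use assms(2) in simp)
  next
    assume "AE x in M. \<bar>f x\<bar> \<le> t"
    then show "AE x in M. ennreal \<bar>ae_rep (ae_class M f) x\<bar> \<le> ennreal t"
      using rep(2) by eventually_elim (use assms(2) in simp)
  qed
  finally show ?thesis .
qed

section \<open>Reproducing kernel Hilbert spaces and the spectrum of the embedding\<close>

context rkhs
begin

lemma restrict_add_mult: "(\<lambda>x\<in>X. f x + (\<lambda>x\<in>X. c * g x) x) = (\<lambda>x\<in>X. f x + c * g x)"
  by (rule restrict_ext) simp

lemma add_mult_closed: "\<lbrakk>f \<in> H; g \<in> H\<rbrakk> \<Longrightarrow> (\<lambda>x\<in>X. f x + c * g x) \<in> H"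
  using add_closed[OF _ scale_closed, of f g c] by (simp only: restrict_add_mult)

lemma ip_add_mult_left:
  assumes "f \<in> H" "g \<in> H" "h \<in> H"
  shows "ip (\<lambda>x\<in>X. f x + c * g x) h = ip f h + c * ip g h"
  using ip_add[OF assms(1) scale_closed[OF assms(2)] assms(3), of c] ip_scale[OF assms(2,3)]
  by (simp only: restrict_add_mult)

lemma ip_square_add_mult:
  assumes "f \<in> H" "g \<in> H"
  shows "ip (\<lambda>x\<in>X. f x + c * g x) (\<lambda>x\<in>X. f x + c * g x) = ip f f + 2 * c * ip f g + c\<^sup>2 * ip g g"
proof -
  define u where "u = (\<lambda>x\<in>X. f x + c * g x)"
  have u: "u \<in> H" unfolding u_def using assms by (rule add_mult_closed)
  have left: "ip u h = ip f h + c * ip g h" if "h \<in> H" for h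
    unfolding u_def using assms that by (rule ip_add_mult_left)
  have "ip u u = ip u f + c * ip u g"
    using left[OF u] ip_commute[OF u] assms by simp
  also have "\<dots> = ip f f + 2 * c * ip f g + c\<^sup>2 * ip g g"
    using left[OF assms(1)] left[OF assms(2)] ip_commute[OF assms]
    by (simp add: power2_eq_square algebra_simps)
  finally show ?thesis by (simp only: u_def)
qed

lemma sum_closed:
  assumes "finite A" "\<And>i. i \<in> A \<Longrightarrow> f i \<in> H"
  shows "(\<lambda>x\<in>X. \<Sum>i\<in>A. c i * f i x) \<in> H"
  using assms
proof (induction A rule: finite_induct)
  case empty
  then show ?case using zero_closed by (simp only: sum.empty)
next
  case (insert a A)
  let ?S = "\<lambda>x\<in>X. \<Sum>i\<in>A. c i * f i x"
  have "(\<lambda>x\<in>X. ?S x + c a * f a x) \<in> H"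
    using insert by (intro add_mult_closed) auto
  also have "(\<lambda>x\<in>X. ?S x + c a * f a x) = (\<lambda>x\<in>X. \<Sum>i\<in>insert a A. c i * f i x)"
    using insert by (intro restrict_ext) simp
  finally show ?case .
qed

lemma diff_closed: "\<lbrakk>f \<in> H; g \<in> H\<rbrakk> \<Longrightarrow> (\<lambda>x\<in>X. f x - g x) \<in> H"
  using add_mult_closed[of f g "-1"] by simp

lemma ip_diff_left:
  "\<lbrakk>f \<in> H; g \<in> H; h \<in> H\<rbrakk> \<Longrightarrow> ip (\<lambda>x\<in>X. f x - g x) h = ip f h - ip g h"
  using ip_add_mult_left[of f g h "-1"] by simp

lemma ip_Cauchy_Schwarz:
  assumes "f \<in> H" "g \<in> H"
  shows "(ip f g)\<^sup>2 \<le> ip f f * ip g g"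
proof (rule quadratic_nonneg_imp_discriminant)
  fix t
  show "0 \<le> ip f f + 2 * t * ip f g + t\<^sup>2 * ip g g"
    using ip_nonneg[OF add_mult_closed[OF assms, of t]] ip_square_add_mult[OF assms] by simp
qed (use assms ip_nonneg in simp)

lemma Metric_space_H: "Metric_space H (function_dist X H ip)"
proof
  fix f g
  show "0 \<le> function_dist X H ip f g"
    by (simp add: function_dist_def ip_nonneg diff_closed)
  show "function_dist X H ip f g = function_dist X H ip g f"
  proof (cases "f \<in> H \<and> g \<in> H")
    case True
    have "(\<lambda>x\<in>X. g x - f x) = (\<lambda>x\<in>X. - 1 * (\<lambda>x\<in>X. f x - g x) x)"
      by (auto simp: restrict_def)
    then have "ip (\<lambda>x\<in>X. g x - f x) (\<lambda>x\<in>X. g x - f x) = ip (\<lambda>x\<in>X. f x - g x) (\<lambda>x\<in>X. f x - g x)"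
      using True ip_scale[OF diff_closed scale_closed[OF diff_closed], of f g f g "-1" "-1"]
        ip_scale[OF diff_closed diff_closed, of f g f g "-1"]
        ip_commute[OF diff_closed scale_closed[OF diff_closed], of f g f g "-1"]
      by simp
    then show ?thesis using True by (simp add: function_dist_def)
  qed (auto simp: function_dist_def)
next
  fix f g assume fg: "f \<in> H" "g \<in> H"
  show "function_dist X H ip f g = 0 \<longleftrightarrow> f = g"
  proof
    assume "function_dist X H ip f g = 0"
    then have "(\<lambda>x\<in>X. f x - g x) = (\<lambda>x\<in>X. 0)"
      using fg by (intro ip_definite diff_closed) (simp_all add: function_dist_def)
    then have "f x = g x" if "x \<in> X" for x
      using that by (auto dest!: fun_cong[of _ _ x])
    then show "f = g" using fg functions_on by (intro extensionalityI[of f X]) auto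
  next
    assume "f = g"
    have "ip (\<lambda>x\<in>X. 0 * g x) (\<lambda>x\<in>X. 0) = 0"
      using ip_scale[OF fg(2) zero_closed, of 0] by simp
    then show "function_dist X H ip f g = 0"
      using \<open>f = g\<close> fg by (simp add: function_dist_def)
  qed
next
  fix f g h assume fgh: "f \<in> H" "g \<in> H" "h \<in> H"
  let ?u = "\<lambda>x\<in>X. f x - g x" and ?v = "\<lambda>x\<in>X. g x - h x"
  have uv: "?u \<in> H" "?v \<in> H" using fgh by (auto intro: diff_closed)
  have "(\<lambda>x\<in>X. f x - h x) = (\<lambda>x\<in>X. ?u x + 1 * ?v x)" by (auto simp: restrict_def)
  then have "ip (\<lambda>x\<in>X. f x - h x) (\<lambda>x\<in>X. f x - h x) = ip ?u ?u + 2 * ip ?u ?v + ip ?v ?v"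
    using ip_square_add_mult[OF uv, of 1] by simp
  then show "function_dist X H ip f h \<le> function_dist X H ip f g + function_dist X H ip g h"
    using fgh sqrt_add_le[OF ip_Cauchy_Schwarz[OF uv]] uv
    by (simp add: function_dist_def ip_nonneg)
qed

text \<open>The quadratic functional \<open>J f = ip f f - 2 * L f\<close> is bounded below, and its derivative at \<open>f\<close>,
which is \<open>ip f g - L g\<close> up to a factor 2, is controlled by how far \<open>J f\<close> is from the infimum. For a minimising sequence this estimate, applied to
\<open>g = s n - s k\<close>, yields the Cauchy property, and applied to a fixed \<open>g\<close> it shows that the limit represents \<open>L\<close>.\<close>
lemma Riesz_representation:
  assumes linear: "\<And>f g c. \<lbrakk>f \<in> H; g \<in> H\<rbrakk> \<Longrightarrow> L (\<lambda>x\<in>X. f x + c * g x) = L f + c * L g"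
    and bounded: "\<And>f. \<lbrakk>f \<in> H; ip f f \<le> 1\<rbrakk> \<Longrightarrow> \<bar>L f\<bar> \<le> B"
  shows "\<exists>h\<in>H. \<forall>f\<in>H. ip f h = L f"
proof -
  interpret Metric_space H "function_dist X H ip" by (rule Metric_space_H)
  define J where "J f = ip f f - 2 * L f" for f
  have J_shift: "J (\<lambda>x\<in>X. f x + t * g x) = J f + 2 * t * (ip f g - L g) + t\<^sup>2 * ip g g"
    if "f \<in> H" "g \<in> H" for f g t
    using that by (simp add: J_def ip_square_add_mult linear algebra_simps)
  have L_zero: "L (\<lambda>x\<in>X. 0) = 0"
    using linear[OF zero_closed zero_closed, of 1] by (simp cong: restrict_cong)
  have L_bound: "\<bar>L f\<bar> \<le> B * sqrt (ip f f)" if f: "f \<in> H" for f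
  proof (cases "ip f f = 0")
    case True
    then show ?thesis using ip_definite[OF f] L_zero by simp
  next
    case False
    define s where "s = sqrt (ip f f)"
    have s: "s > 0" "s * s = ip f f" using False ip_nonneg[OF f] by (auto simp: s_def)
    let ?g = "\<lambda>x\<in>X. (\<lambda>x\<in>X. 0) x + 1 / s * f x"
    have g: "?g \<in> H" by (rule add_mult_closed[OF zero_closed f])
    have zero: "ip (\<lambda>x\<in>X. 0) h = 0" if "h \<in> H" for h
      using ip_scale[OF zero_closed that, of 0] by simp
    have "ip ?g ?g = (1 / s)\<^sup>2 * ip f f"
      unfolding ip_square_add_mult[OF zero_closed f] by (simp add: zero[OF f] zero[OF zero_closed])
    also have "\<dots> = 1" using s False by (simp add: power2_eq_square flip: s(2))
    finally have "ip ?g ?g = 1" .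
    moreover have "L ?g = L f / s" unfolding linear[OF zero_closed f] by (simp add: L_zero)
    ultimately have "\<bar>L f / s\<bar> \<le> B" using bounded[OF g] by (simp only: order_refl)
    then have "\<bar>L f\<bar> / s \<le> B" using s by simp
    then show ?thesis using s by (simp add: divide_le_eq s_def)
  qed
  have "- B\<^sup>2 \<le> J f" if "f \<in> H" for f
  proof -
    have "0 \<le> (sqrt (ip f f) - B)\<^sup>2" by simp
    then show ?thesis
      using L_bound[OF that] ip_nonneg[OF that] by (simp add: J_def power2_diff algebra_simps)
  qed
  then have bdd: "bdd_below (J ` H)" by (rule bdd_belowI2)
  define m where "m = (INF f\<in>H. J f)"
  have m: "m \<le> J f" if "f \<in> H" for f unfolding m_def by (rule cINF_lower[OF bdd that])
  \<comment> \<open>The discriminant of \<open>t \<mapsto> J (f + t * g) - m\<close>, a non-negative quadratic polynomial, is not positive.\<close>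
  have near: "(ip f g - L g)\<^sup>2 \<le> (J f - m) * ip g g" if "f \<in> H" "g \<in> H" for f g
  proof (rule quadratic_nonneg_imp_discriminant)
    fix t
    show "0 \<le> J f - m + 2 * t * (ip f g - L g) + t\<^sup>2 * ip g g"
      using m[OF add_mult_closed[OF that, of t]] J_shift[OF that] by simp
  qed (use that ip_nonneg in simp)
  have "\<exists>f\<in>H. J f < m + (1 / real (Suc n))\<^sup>2" for n
    using cINF_less_iff[of H J] bdd zero_closed unfolding m_def
    by (metis empty_iff less_add_same_cancel1 of_nat_0_less_iff zero_less_Suc zero_less_divide_1_iff zero_less_power)
  then obtain s where s: "\<And>n. s n \<in> H" "\<And>n. J (s n) < m + (1 / real (Suc n))\<^sup>2" by metis
  have approx: "\<bar>ip (s n) g - L g\<bar> \<le> 1 / real (Suc n) * sqrt (ip g g)" if "g \<in> H" for n g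
  proof -
    have "(ip (s n) g - L g)\<^sup>2 \<le> (J (s n) - m) * ip g g" using near[OF s(1) that] .
    also have "\<dots> \<le> (1 / real (Suc n))\<^sup>2 * ip g g"
      using s(2)[of n] ip_nonneg[OF that] by (intro mult_right_mono) auto
    finally have "sqrt ((ip (s n) g - L g)\<^sup>2) \<le> sqrt ((1 / real (Suc n))\<^sup>2 * ip g g)"
      by (rule real_sqrt_le_mono)
    then show ?thesis by (simp add: real_sqrt_mult)
  qed
  have cauchy: "function_dist X H ip (s n) (s k) \<le> 1 / real (Suc n) + 1 / real (Suc k)" for n k
  proof -
    let ?g = "\<lambda>x\<in>X. s n x - s k x"
    have g: "?g \<in> H" using s diff_closed by blast
    define d where "d = sqrt (ip ?g ?g)"
    have d: "d \<ge> 0" "d * d = ip ?g ?g" using ip_nonneg[OF g] by (auto simp: d_def)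
    have "d * d = (ip (s n) ?g - L ?g) - (ip (s k) ?g - L ?g)"
      using ip_diff_left[OF s(1) s(1) g, of n k] d by simp
    also have "\<dots> \<le> 1 / real (Suc n) * d + 1 / real (Suc k) * d"
      using approx[OF g, of n] approx[OF g, of k] unfolding d_def by linarith
    finally have "d * d \<le> (1 / real (Suc n) + 1 / real (Suc k)) * d" by (simp add: distrib_right)
    then have "d \<le> 1 / real (Suc n) + 1 / real (Suc k)"
      using d mult_right_le_imp_le[of d d] by (cases "d = 0") auto
    then show ?thesis using s by (simp add: function_dist_def d_def)
  qed
  have "MCauchy s"
    unfolding MCauchy_def
  proof (intro conjI allI impI)
    show "range s \<subseteq> H" using s by auto
    fix \<epsilon> :: real assume "\<epsilon> > 0"
    then obtain N where N: "1 / real (Suc N) < \<epsilon> / 2"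
      using reals_Archimedean[of "\<epsilon> / 2"] by (auto simp: inverse_eq_divide)
    have "function_dist X H ip (s n) (s k) < \<epsilon>" if "N \<le> n" "N \<le> k" for n k
    proof -
      have "1 / real (Suc n) \<le> 1 / real (Suc N)" "1 / real (Suc k) \<le> 1 / real (Suc N)"
        using that by (auto intro!: divide_left_mono)
      then show ?thesis using cauchy[of n k] N by linarith
    qed
    then show "\<exists>N. \<forall>n n'. N \<le> n \<longrightarrow> N \<le> n' \<longrightarrow> function_dist X H ip (s n) (s n') < \<epsilon>" by blast
  qed
  then obtain h where "limitin mtopology s h sequentially"
    using complete unfolding mcomplete_def by blast
  then have h: "h \<in> H" and lim: "(\<lambda>n. function_dist X H ip (s n) h) \<longlonglongrightarrow> 0"
    by (auto simp: limitin_metric_dist_null)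
  have "ip f h = L f" if f: "f \<in> H" for f
  proof -
    have "(\<lambda>n. ip (s n) f - ip h f) \<longlonglongrightarrow> 0"
    proof (rule tendsto_rabs_zero_cancel, rule tendsto_sandwich[where f = "\<lambda>_. 0"])
      show "(\<lambda>n. function_dist X H ip (s n) h * sqrt (ip f f)) \<longlonglongrightarrow> 0"
        using tendsto_mult_left_zero[OF lim] .
      have "\<bar>ip (s n) f - ip h f\<bar> \<le> function_dist X H ip (s n) h * sqrt (ip f f)" for n
      proof -
        have "sqrt ((ip (s n) f - ip h f)\<^sup>2) \<le> function_dist X H ip (s n) h * sqrt (ip f f)"
          using real_sqrt_le_mono[OF ip_Cauchy_Schwarz[OF diff_closed[OF s(1) h] f, of n]] s(1)[of n] h f
          by (simp add: function_dist_def real_sqrt_mult ip_diff_left)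
        then show ?thesis by simp
      qed
      then show "\<forall>\<^sub>F n in sequentially. \<bar>ip (s n) f - ip h f\<bar>
          \<le> function_dist X H ip (s n) h * sqrt (ip f f)" by simp
    qed auto
    moreover have "(\<lambda>n. ip (s n) f - L f) \<longlonglongrightarrow> 0"
    proof (rule tendsto_rabs_zero_cancel, rule tendsto_sandwich[where f = "\<lambda>_. 0"])
      show "(\<lambda>n. 1 / real (Suc n) * sqrt (ip f f)) \<longlonglongrightarrow> 0"
        using tendsto_mult_left_zero[OF LIMSEQ_inverse_real_of_nat] by (simp add: inverse_eq_divide)
    qed (use approx[OF f] in auto)
    ultimately have "(\<lambda>n. (ip (s n) f - ip h f) - (ip (s n) f - L f)) \<longlonglongrightarrow> 0 - 0"
      by (rule tendsto_diff)
    then have "(\<lambda>n. L f - ip h f) \<longlonglongrightarrow> 0" by simp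
    then have "L f - ip h f = 0" by (simp only: LIMSEQ_const_iff)
    then show ?thesis using ip_commute[OF f h] by simp
  qed
  then show ?thesis using h by blast
qed

end

lemma compactly_embedded_bounded:
  assumes "rkhs (space M) H ip k" "compactly_embedded M H ip"
  obtains B where "\<And>f. \<lbrakk>f \<in> H; ip f f \<le> 1\<rbrakk> \<Longrightarrow> (LINT x|M. (f x)\<^sup>2) \<le> B\<^sup>2"
proof -
  interpret rkhs "space M" H ip k by fact
  interpret L2: Metric_space "L2 M" "L2_dist M" by (rule Metric_space_L2)
  have H: "H \<subseteq> square_integrable M" using assms(2) by (simp add: compactly_embedded_def)
  let ?U = "ae_class M ` {f \<in> H. sqrt (ip f f) \<le> 1}"
  have "L2.mbounded (L2.mtopology closure_of ?U)"
    using assms(2) by (intro L2.compactin_imp_mbounded) (simp add: compactly_embedded_def L2_topology_eq)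
  moreover have "?U \<subseteq> L2 M" using H by (auto simp: L2_def)
  then have "?U \<subseteq> L2.mtopology closure_of ?U" by (simp add: closure_of_subset)
  ultimately have "L2.mbounded ?U" using L2.mbounded_subset by blast
  then have "\<exists>B. \<forall>F\<in>?U. \<forall>G\<in>?U. L2_dist M F G \<le> B" by (simp only: L2.mbounded_alt)
  then obtain B where B: "\<forall>F\<in>?U. \<forall>G\<in>?U. L2_dist M F G \<le> B" ..
  have zero: "ip (\<lambda>x\<in>space M. 0) (\<lambda>x\<in>space M. 0) = 0"
    using ip_scale[OF zero_closed zero_closed, of 0] by (simp only: mult_zero_left)
  show thesis
  proof (rule that[of B])
    fix f assume f: "f \<in> H" "ip f f \<le> 1"
    have "L2_dist M (ae_class M f) (ae_class M (\<lambda>x\<in>space M. 0)) \<le> B"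
      using f zero zero_closed by (intro B[rule_format]) auto
    moreover have "L2_dist M (ae_class M f) (ae_class M (\<lambda>x\<in>space M. 0))
        = sqrt (LINT x|M. (f x - (\<lambda>x\<in>space M. 0) x)\<^sup>2)"
      using f zero_closed H by (intro L2_dist_ae_class square_integrable_measurable) auto
    moreover have "(LINT x|M. (f x - (\<lambda>x\<in>space M. 0) x)\<^sup>2) = (LINT x|M. (f x)\<^sup>2)"
      by (intro Bochner_Integration.integral_cong) auto
    ultimately show "(LINT x|M. (f x)\<^sup>2) \<le> B\<^sup>2"
      by (simp add: sqrt_le_D)
  qed
qed

text \<open>The description of the adjoint by \<open>THE\<close> is justified: the functional is bounded because the embedding is, and
definiteness of the inner product gives uniqueness.\<close>
lemma embedding_adjoint:
  assumes "rkhs (space M) H ip k" "compactly_embedded M H ip" and g: "g \<in> square_integrable M"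
  shows "embedding_adjoint M H ip (ae_class M g) \<in> H"
    and "f \<in> H \<Longrightarrow> ip f (embedding_adjoint M H ip (ae_class M g)) = (LINT x|M. f x * g x)"
proof -
  interpret rkhs "space M" H ip k by fact
  have H: "f \<in> square_integrable M" if "f \<in> H" for f
    using assms(2) that by (auto simp: compactly_embedded_def)
  let ?L = "\<lambda>f. LINT x|M. f x * g x"
  obtain B where B: "\<And>f. \<lbrakk>f \<in> H; ip f f \<le> 1\<rbrakk> \<Longrightarrow> (LINT x|M. (f x)\<^sup>2) \<le> B\<^sup>2"
    using compactly_embedded_bounded[OF assms(1,2)] by blast
  have "\<exists>h\<in>H. \<forall>f\<in>H. ip f h = ?L f"
  proof (rule Riesz_representation)
    fix f f' c assume f: "f \<in> H" "f' \<in> H"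
    have "?L (\<lambda>x\<in>space M. f x + c * f' x) = (LINT x|M. f x * g x + c * (f' x * g x))"
      by (intro Bochner_Integration.integral_cong) (auto simp: algebra_simps)
    then show "?L (\<lambda>x\<in>space M. f x + c * f' x) = ?L f + c * ?L f'"
      using square_integrable_mult[OF H g] f by simp
  next
    fix f assume f: "f \<in> H" "ip f f \<le> 1"
    have "(?L f)\<^sup>2 \<le> (LINT x|M. (f x)\<^sup>2) * (LINT x|M. (g x)\<^sup>2)"
      by (rule L2_Cauchy_Schwarz[OF H[OF f(1)] g])
    also have "\<dots> \<le> B\<^sup>2 * (LINT x|M. (g x)\<^sup>2)"
      using B[OF f] by (intro mult_right_mono integral_nonneg_AE) auto
    finally have "sqrt ((?L f)\<^sup>2) \<le> sqrt (B\<^sup>2 * (LINT x|M. (g x)\<^sup>2))" by (rule real_sqrt_le_mono)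
    then show "\<bar>?L f\<bar> \<le> sqrt (B\<^sup>2 * (LINT x|M. (g x)\<^sup>2))" by simp
  qed
  then obtain h where h: "h \<in> H" "\<And>f. f \<in> H \<Longrightarrow> ip f h = ?L f" by blast
  have "embedding_adjoint M H ip (ae_class M g) = h"
    unfolding embedding_adjoint_def
  proof (rule the_equality)
    show "h \<in> H \<and> (\<forall>f\<in>H. ip f h = L2_inner M (ae_class M f) (ae_class M g))"
      using h H g by (simp add: L2_inner_ae_class square_integrable_measurable)
  next
    fix h' assume h': "h' \<in> H \<and> (\<forall>f\<in>H. ip f h' = L2_inner M (ae_class M f) (ae_class M g))"
    let ?d = "\<lambda>x\<in>space M. h' x - h x"
    have d: "?d \<in> H" using h h' diff_closed by blast
    have "ip ?d h' = ip ?d h"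
      using h' h(2)[OF d] d H[OF d] g by (simp add: L2_inner_ae_class square_integrable_measurable)
    then have "ip ?d ?d = 0"
      using ip_diff_left[OF _ h(1) d, of h'] h' ip_commute[OF d h(1)] ip_commute[OF d, of h'] by simp
    then have "function_dist (space M) H ip h' h = 0"
      unfolding function_dist_def by (simp only: real_sqrt_zero if_cancel)
    then show "h' = h" using Metric_space.zero[OF Metric_space_H, of h' h] h(1) h' by simp
  qed
  then show "embedding_adjoint M H ip (ae_class M g) \<in> H"
    and "f \<in> H \<Longrightarrow> ip f (embedding_adjoint M H ip (ae_class M g)) = (LINT x|M. f x * g x)"
    using h by auto
qed

text \<open>For the adjoint image \<open>h\<close> of a normalised eigenvector \<open>g\<close>, the eigenvalue is \<open>LINT x|M. h x * g x = ip h h\<close>.\<close>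
lemma eigenvalue_nonneg:
  assumes "rkhs (space M) H ip k" "compactly_embedded M H ip" and g: "g \<in> square_integrable M"
    and norm: "(LINT x|M. g x * g x) = 1"
    and eigen: "kernel_operator M H ip (ae_class M g) = class_scale M l (ae_class M g)"
  shows "0 \<le> l"
proof -
  interpret rkhs "space M" H ip k by fact
  define h where "h = embedding_adjoint M H ip (ae_class M g)"
  have h: "h \<in> H" "ip h h = (LINT x|M. h x * g x)"
    using embedding_adjoint[OF assms(1-3)] by (auto simp: h_def)
  then have hm: "h \<in> borel_measurable M"
    using assms(2) by (auto simp: compactly_embedded_def square_integrable_def)
  note gm = square_integrable_measurable[OF g]
  have "ae_class M h = ae_class M (\<lambda>x. l * g x)"
    using eigen by (simp add: kernel_operator_def h_def[symmetric] class_scale_ae_class[OF gm])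
  then have "AE x in M. h x = l * g x" using ae_class_eq_iff[OF hm] by simp
  then have "(LINT x|M. h x * g x) = (LINT x|M. l * (g x * g x))"
    using hm gm by (intro integral_cong_AE) (auto simp: borel_measurable_times)
  then show ?thesis using h ip_nonneg[OF h(1)] norm by simp
qed

text \<open>Infinitely many eigenvalues beyond \<open>\<delta>\<close> would provide infinitely many functions \<open>sqrt (\<mu> i) * e i\<close> in the
unit ball of \<open>H\<close> whose classes have mutual distances \<open>sqrt (\<mu> i + \<mu> j) > sqrt \<delta>\<close>, contradicting compactness.\<close>
lemma finitely_many_large_eigenvalues:
  assumes "rkhs (space M) H ip k" "compactly_embedded M H ip"
    and e: "eigenfunctions M H ip I \<mu> e" and pos: "\<And>i. i \<in> I \<Longrightarrow> 0 < \<mu> i" and "0 < \<delta>"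
  shows "finite {i \<in> I. \<delta> < \<mu> i}"
proof (rule ccontr)
  assume inf: "infinite {i \<in> I. \<delta> < \<mu> i}"
  interpret rkhs "space M" H ip k by fact
  interpret L2: Metric_space "L2 M" "L2_dist M" by (rule Metric_space_L2)
  have H: "f \<in> square_integrable M" if "f \<in> H" for f
    using assms(2) that by (auto simp: compactly_embedded_def)
  obtain s :: "nat \<Rightarrow> nat" where s: "strict_mono s" "\<And>n. s n \<in> I \<and> \<delta> < \<mu> (s n)"
    using infinite_enumerate[OF inf] by auto
  have eH: "e (s n) \<in> H" for n using e s by (auto simp: eigenfunctions_def)
  note eL = H[OF eH]
  define \<phi> where "\<phi> n = (\<lambda>x\<in>space M. sqrt (\<mu> (s n)) * e (s n) x)" for n
  let ?U = "ae_class M ` {f \<in> H. sqrt (ip f f) \<le> 1}"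
  let ?\<sigma> = "\<lambda>n. ae_class M (\<phi> n)"
  have \<phi>: "\<phi> n \<in> H" "ip (\<phi> n) (\<phi> n) = 1" for n
    using scale_closed[OF eH] e s by (auto simp: \<phi>_def eigenfunctions_def)
  have "?U \<subseteq> L2 M" using H by (auto simp: L2_def)
  then have "?U \<subseteq> L2.mtopology closure_of ?U" by (simp add: closure_of_subset)
  then have "range ?\<sigma> \<subseteq> L2.mtopology closure_of ?U" using \<phi> by auto
  moreover have "compactin L2.mtopology (L2.mtopology closure_of ?U)"
    using assms(2) by (simp add: compactly_embedded_def L2_topology_eq)
  ultimately obtain l r where r: "strict_mono (r :: nat \<Rightarrow> nat)"
    and "limitin L2.mtopology (?\<sigma> \<circ> r) l sequentially"
    unfolding L2.compactin_sequentially by meson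
  then have "L2.MCauchy (?\<sigma> \<circ> r)"
    using L2.convergent_imp_MCauchy[of "?\<sigma> \<circ> r" l] H \<phi> by (auto simp: L2_def)
  then obtain N where N: "\<And>n n'. N \<le> n \<Longrightarrow> N \<le> n' \<Longrightarrow> L2_dist M (?\<sigma> (r n)) (?\<sigma> (r n')) < sqrt \<delta>"
    using \<open>0 < \<delta>\<close> unfolding L2.MCauchy_def by (metis comp_apply real_sqrt_gt_zero)
  define a b where "a = s (r N)" and "b = s (r (Suc N))"
  have ab: "a \<in> I" "b \<in> I" "a \<noteq> b" "\<delta> < \<mu> a" "\<delta> < \<mu> b"
    using s r strict_mono_eq[of r] strict_mono_eq[of s] by (auto simp: a_def b_def)
  have "L2_inner M (ae_class M (e i)) (ae_class M (e j)) = (if i = j then 1 else 0)"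
    if "i \<in> I" "j \<in> I" for i j using e that by (auto simp: eigenfunctions_def)
  moreover have eI: "e i \<in> square_integrable M" if "i \<in> I" for i
    using e that H by (auto simp: eigenfunctions_def)
  ultimately have orth: "(LINT x|M. e i x * e j x) = (if i = j then 1 else 0)"
    if "i \<in> I" "j \<in> I" for i j
    using that by (simp add: L2_inner_ae_class square_integrable_measurable)
  have int: "integrable M (\<lambda>x. e i x * e j x)" if "i \<in> I" "j \<in> I" for i j
    using that eI square_integrable_mult by blast
  have "(LINT x|M. (\<phi> (r N) x - \<phi> (r (Suc N)) x)\<^sup>2)
      = (LINT x|M. \<mu> a * (e a x * e a x) - 2 * sqrt (\<mu> a) * sqrt (\<mu> b) * (e a x * e b x)
          + \<mu> b * (e b x * e b x))"
    using pos ab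
    by (intro Bochner_Integration.integral_cong)
       (auto simp: \<phi>_def a_def b_def power2_diff power_mult_distrib less_imp_le power2_eq_square[symmetric])
  also have "\<dots> = \<mu> a + \<mu> b" using ab orth int by simp
  finally have "L2_dist M (?\<sigma> (r N)) (?\<sigma> (r (Suc N))) = sqrt (\<mu> a + \<mu> b)"
    using \<phi> H by (simp add: L2_dist_ae_class square_integrable_measurable)
  moreover have "sqrt \<delta> \<le> sqrt (\<mu> a + \<mu> b)" using ab \<open>0 < \<delta>\<close> by (intro real_sqrt_le_mono) auto
  ultimately show False using N[of N "Suc N"] by simp
qed

section \<open>Embeddings of power spaces into the essentially bounded classes\<close>

locale orthonormal_system = dyadic_weights I \<mu> for I \<mu> +
  fixes M :: "'a measure" and e :: "nat \<Rightarrow> 'a \<Rightarrow> real"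
  assumes in_L2: "i \<in> I \<Longrightarrow> e i \<in> square_integrable M"
    and orthonormal: "\<lbrakk>i \<in> I; j \<in> I\<rbrakk> \<Longrightarrow> (LINT x|M. e i x * e j x) = (if i = j then 1 else 0)"
begin

abbreviation seq_norm :: "real \<Rightarrow> ennreal \<Rightarrow> 'a \<Rightarrow> ennreal" where
  "seq_norm \<theta> q x \<equiv> weighted_norm I \<mu> \<theta> q (\<lambda>i. e i x * \<mu> i powr \<theta>)"

lemma borel_measurable_seq_norm: "seq_norm \<theta> q \<in> borel_measurable M"
  using in_L2 by (intro borel_measurable_weighted_norm borel_measurable_times)
    (auto intro: square_integrable_measurable)

text \<open>Orthonormality makes the coefficients of a class on \<open>I\<close> unique, and the weighted norm looks only at these.\<close>
lemma power_norm_eq: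
  assumes "L2_series M I e b F"
  shows "power_norm M I \<mu> e \<theta> r F = weighted_norm I \<mu> \<theta> r b"
  unfolding power_norm_def
proof (rule the_equality)
  show "\<exists>b'. L2_series M I e b' F \<and> weighted_norm I \<mu> \<theta> r b = weighted_norm I \<mu> \<theta> r b'"
    using assms by blast
next
  fix c assume "\<exists>b'. L2_series M I e b' F \<and> c = weighted_norm I \<mu> \<theta> r b'"
  then obtain b' where b': "L2_series M I e b' F" "c = weighted_norm I \<mu> \<theta> r b'" by blast
  obtain f where f: "f \<in> square_integrable M" "F = ae_class M f"
    using L2_series_in_L2[OF assms] by (auto simp: L2_def)
  have coeff: "d i = (LINT x|M. f x * e i x)" if "L2_series M I e d F" "i \<in> I" for d i
    by (rule L2_series_coefficient[OF in_L2 orthonormal f(1)]) (use that f(2) in simp_all)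
  have "weighted_norm I \<mu> \<theta> r b' = weighted_norm I \<mu> \<theta> r b"
    by (rule weighted_norm_cong) (simp add: coeff[OF b'(1)] coeff[OF assms])
  then show "c = weighted_norm I \<mu> \<theta> r b" using b'(2) by simp
qed

text \<open>By the weighted Hoelder inequality all partial sums obey the same pointwise bound, which passes to the \<open>L2\<close>
limit.\<close>
lemma Linf_norm_series_le:
  assumes conj: "1 \<le> r" "1 \<le> r'" "1 / r + 1 / r' = 1" and \<kappa>: "0 \<le> \<kappa>"
    and bound: "AE x in M. seq_norm \<theta> r' x \<le> ennreal \<kappa>"
    and F: "L2_series M I e b F" and t: "0 \<le> t" "weighted_norm I \<mu> \<theta> r b \<le> ennreal t"
  shows "Linf_norm M F \<le> ennreal (t * \<kappa>)"
proof -
  obtain f where f: "f \<in> square_integrable M" "F = ae_class M f"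
    using L2_series_in_L2[OF F] by (auto simp: L2_def)
  have "AE x in M. \<bar>f x\<bar> \<le> t * \<kappa>"
  proof (rule L2_limit_abs_le[OF _ f(1)])
    show "(\<lambda>x. \<Sum>i\<in>I \<inter> {..n}. b i * e i x) \<in> square_integrable M" for n
      using in_L2 by (intro square_integrable_sum) auto
    show "(\<lambda>n. LINT x|M. ((\<Sum>i\<in>I \<inter> {..n}. b i * e i x) - f x)\<^sup>2) \<longlonglongrightarrow> 0"
      using F unfolding f(2) by (subst (asm) L2_series_iff[OF in_L2 f(1)])
    show "AE x in M. \<forall>n. \<bar>\<Sum>i\<in>I \<inter> {..n}. b i * e i x\<bar> \<le> t * \<kappa>"
      using bound
    proof eventually_elim
      case (elim x)
      then show ?case using weighted_Holder[OF conj t \<kappa> elim] by simp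
    qed
  qed
  then show ?thesis
    using f t \<kappa> by (simp add: Linf_norm_ae_class_le_iff square_integrable_measurable)
qed

text \<open>Continuity is stated through differences of classes; these are again represented by series, so that the
bound on a single series settles continuity and operator norm alike.\<close>
lemma embedding_if_AE_bounded:
  assumes conj: "1 \<le> r" "1 \<le> r'" "1 / r + 1 / r' = 1" and \<kappa>: "0 < \<kappa>"
    and bound: "AE x in M. seq_norm \<theta> r' x \<le> ennreal \<kappa>"
  shows "continuously_embedded M
      (power_space M I \<mu> e \<theta> r) (power_norm M I \<mu> e \<theta> r) (Linf M) (Linf_norm M)"
    and "embedding_norm (power_space M I \<mu> e \<theta> r) (power_norm M I \<mu> e \<theta> r) (Linf_norm M)
      \<le> ennreal \<kappa>"
proof -
  let ?E = "power_space M I \<mu> e \<theta> r" and ?n = "power_norm M I \<mu> e \<theta> r"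
  have le: "Linf_norm M F \<le> ennreal (t * \<kappa>)"
    if "L2_series M I e b F" "0 \<le> t" "?n F \<le> ennreal t" for b F t
    using that \<kappa> by (intro Linf_norm_series_le[OF conj _ bound that(1)]) (auto simp: power_norm_eq)
  have series: "\<exists>b. L2_series M I e b F \<and> ?n F < \<infinity>" if "F \<in> ?E" for F
    using that by (auto simp: power_space_def power_norm_eq)
  show "embedding_norm ?E ?n (Linf_norm M) \<le> ennreal \<kappa>"
    unfolding embedding_norm_def
  proof (rule SUP_least)
    fix u assume "u \<in> {u \<in> ?E. ?n u \<le> 1}"
    then show "Linf_norm M u \<le> ennreal \<kappa>" using series le[of _ u 1] by auto
  qed
  have "?E \<subseteq> Linf M"
  proof
    fix F assume F: "F \<in> ?E"
    then obtain b where b: "L2_series M I e b F" "?n F < \<infinity>" using series by blast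
    then have "?n F \<le> ennreal (enn2real (?n F))" by simp
    then have "Linf_norm M F < \<infinity>"
      using le[OF b(1), of "enn2real (?n F)"] by (auto intro: le_less_trans)
    moreover have "F \<in> ae_class M ` borel_measurable M"
      using F by (auto simp: power_space_def L2_def square_integrable_def)
    ultimately show "F \<in> Linf M" by (simp add: Linf_def)
  qed
  moreover have "\<exists>\<delta>>0. \<forall>v\<in>?E. ?n (class_diff M v u) < \<delta> \<longrightarrow> Linf_norm M (class_diff M v u) < \<epsilon>"
    if u: "u \<in> ?E" and \<epsilon>: "0 < \<epsilon>" for u \<epsilon>
  proof -
    \<comment> \<open>As \<open>\<epsilon>\<close> may be infinite, the radius is computed from a positive real below it.\<close>
    obtain \<eta> where \<eta>: "0 < \<eta>" "ennreal \<eta> \<le> \<epsilon>"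
      using \<epsilon> by (cases \<epsilon>) (auto intro: that[of 1])
    have "Linf_norm M (class_diff M v u) < \<epsilon>"
      if v: "v \<in> ?E" and small: "?n (class_diff M v u) < ennreal (\<eta> / \<kappa>)" for v
    proof -
      obtain b c where "L2_series M I e b v" "L2_series M I e c u" using series u v by blast
      then have diff: "L2_series M I e (\<lambda>i. b i - c i) (class_diff M v u)"
        using in_L2 by (intro L2_series_diff)
      obtain t where t: "?n (class_diff M v u) = ennreal t" "0 \<le> t"
        using small by (cases "?n (class_diff M v u)") auto
      then have "t * \<kappa> < \<eta>" using small \<kappa> \<eta> by (simp add: ennreal_less_iff less_divide_eq)
      have "Linf_norm M (class_diff M v u) \<le> ennreal (t * \<kappa>)" using t by (intro le[OF diff]) auto
      also have "\<dots> < ennreal \<eta>" using \<open>t * \<kappa> < \<eta>\<close> \<eta> by (simp add: ennreal_lessI)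
      finally show ?thesis using \<eta> by simp
    qed
    then show ?thesis using \<eta> \<kappa> by (intro exI[of _ "ennreal (\<eta> / \<kappa>)"]) auto
  qed
  ultimately show "continuously_embedded M ?E ?n (Linf M) (Linf_norm M)"
    unfolding continuously_embedded_def by blast
qed

text \<open>A finite combination of the \<open>e i\<close> is its own series, so its power norm is the weighted norm of its
coefficients and the operator norm applies directly.\<close>
lemma finite_combination_AE_le:
  assumes \<kappa>: "0 \<le> \<kappa>"
    and norm: "embedding_norm (power_space M I \<mu> e \<theta> r) (power_norm M I \<mu> e \<theta> r) (Linf_norm M)
      \<le> ennreal \<kappa>"
    and b: "\<And>i. i \<ge> N \<Longrightarrow> b i = 0" "weighted_norm I \<mu> \<theta> r b \<le> 1"
  shows "AE x in M. \<bar>\<Sum>i\<in>I \<inter> {..<N}. b i * e i x\<bar> \<le> \<kappa>"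
proof -
  let ?f = "\<lambda>x. \<Sum>i\<in>I \<inter> {..<N}. b i * e i x"
  have f: "?f \<in> square_integrable M" using in_L2 by (intro square_integrable_sum) auto
  have series: "L2_series M I e b (ae_class M ?f)"
    by (rule L2_series_finite_support[OF in_L2 b(1)])
  have "weighted_norm I \<mu> \<theta> r b < \<infinity>" using b(2) by (simp add: le_less_trans)
  then have "ae_class M ?f \<in> power_space M I \<mu> e \<theta> r"
    using f series by (auto simp: power_space_def L2_def)
  then have "Linf_norm M (ae_class M ?f) \<le> ennreal \<kappa>"
    using norm b(2) power_norm_eq[OF series] unfolding embedding_norm_def SUP_le_iff by simp
  then show ?thesis
    using f \<kappa> by (simp add: Linf_norm_ae_class_le_iff square_integrable_measurable)
qed

text \<open>Outside one null set, all rational finite combinations are bounded by \<open>\<kappa>\<close>; at every remaining point duality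
bounds the sequence norm.\<close>
lemma AE_bounded_if_embedding:
  assumes conj: "1 \<le> r" "1 \<le> r'" "1 / r + 1 / r' = 1" and \<kappa>: "0 \<le> \<kappa>"
    and norm: "embedding_norm (power_space M I \<mu> e \<theta> r) (power_norm M I \<mu> e \<theta> r) (Linf_norm M)
      \<le> ennreal \<kappa>"
  shows "AE x in M. seq_norm \<theta> r' x \<le> ennreal \<kappa>"
proof -
  have "AE x in M. \<forall>l. weighted_norm I \<mu> \<theta> r (rational_coeffs l) \<le> 1
      \<longrightarrow> \<bar>\<Sum>i\<in>I \<inter> {..<length l}. rational_coeffs l i * e i x\<bar> \<le> \<kappa>"
    unfolding AE_all_countable
  proof (intro allI)
    fix l
    show "AE x in M. weighted_norm I \<mu> \<theta> r (rational_coeffs l) \<le> 1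
      \<longrightarrow> \<bar>\<Sum>i\<in>I \<inter> {..<length l}. rational_coeffs l i * e i x\<bar> \<le> \<kappa>"
      using finite_combination_AE_le[OF \<kappa> norm, of "length l" "rational_coeffs l"]
      by (cases "weighted_norm I \<mu> \<theta> r (rational_coeffs l) \<le> 1") (auto simp: rational_coeffs_def)
  qed
  then show ?thesis
    by eventually_elim (rule weighted_norm_le_by_rational_duality[OF conj \<kappa>], blast)
qed

text \<open>A finite combination of the \<open>e i\<close> belongs to \<open>H\<close> and is therefore continuous for the initial topology. The set
where it exceeds \<open>\<kappa>\<close> is open and null, hence empty, and duality applies at every point.\<close>
lemma everywhere_bounded_if_embedding:
  assumes conj: "1 \<le> r" "1 \<le> r'" "1 / r + 1 / r' = 1" and \<kappa>: "0 \<le> \<kappa>"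
    and norm: "embedding_norm (power_space M I \<mu> e \<theta> r) (power_norm M I \<mu> e \<theta> r) (Linf_norm M)
      \<le> ennreal \<kappa>"
    and rkhs: "rkhs (space M) H ip k" and e: "\<And>i. i \<in> I \<Longrightarrow> e i \<in> H"
    and positive: "topology_positive (initial_topology (space M) H) M"
    and x: "x \<in> space M"
  shows "seq_norm \<theta> r' x \<le> ennreal \<kappa>"
proof (rule weighted_norm_le_by_rational_duality[OF conj \<kappa>])
  fix l
  let ?N = "length l" and ?b = "rational_coeffs l"
  assume "weighted_norm I \<mu> \<theta> r ?b \<le> 1"
  then have AE: "AE x in M. \<not> \<kappa> < \<bar>\<Sum>i\<in>I \<inter> {..<?N}. ?b i * e i x\<bar>"
    using finite_combination_AE_le[OF \<kappa> norm, of ?N ?b] by (simp add: rational_coeffs_def not_less)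
  define f where "f = (\<lambda>x\<in>space M. \<Sum>i\<in>I \<inter> {..<?N}. ?b i * e i x)"
  have f: "f \<in> H" unfolding f_def using e by (intro rkhs.sum_closed[OF rkhs]) auto
  have U: "open {t :: real. \<kappa> < \<bar>t\<bar>}" by (intro open_Collect_less continuous_intros)
  define A where "A = f -` {t. \<kappa> < \<bar>t\<bar>} \<inter> space M"
  have A: "A = {x \<in> space M. \<kappa> < \<bar>\<Sum>i\<in>I \<inter> {..<?N}. ?b i * e i x\<bar>}"
    by (auto simp: A_def f_def)
  have "openin (initial_topology (space M) H) A"
    unfolding initial_topology_def A_def
    by (intro topology_generated_by_Basis CollectI exI[of _ f] exI[of _ "{t. \<kappa> < \<bar>t\<bar>}"] conjI refl f U)
  moreover have "emeasure M A = 0" unfolding A by (rule emeasure_eq_0_AE[OF AE])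
  ultimately have "A = {}" using positive by (auto simp: topology_positive_def)
  then have "x \<notin> A" by simp
  then show "\<bar>\<Sum>i\<in>I \<inter> {..<?N}. ?b i * e i x\<bar> \<le> \<kappa>" using x by (simp add: A not_less)
qed

end

text \<open>What the spectral theory of the embedding has to supply: positive eigenvalues, finite blocks, and
orthonormal classes.\<close>
lemma eigenfunctions_orthonormal_system:
  assumes rkhs: "rkhs (space M) H ip k" and compact: "compactly_embedded M H ip"
    and \<mu>: "eigenvalue_enumeration M (kernel_operator M H ip) I \<mu>"
    and e: "eigenfunctions M H ip I \<mu> e"
  shows "orthonormal_system I \<mu> M e"
proof
  show L2: "e i \<in> square_integrable M" if "i \<in> I" for i
    using compact e that by (auto simp: compactly_embedded_def eigenfunctions_def)
  have "L2_inner M (ae_class M (e i)) (ae_class M (e j)) = (if i = j then 1 else 0)"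
    if "i \<in> I" "j \<in> I" for i j using e that by (auto simp: eigenfunctions_def)
  then show orth: "(LINT x|M. e i x * e j x) = (if i = j then 1 else 0)" if "i \<in> I" "j \<in> I" for i j
    using that L2 by (simp add: L2_inner_ae_class square_integrable_measurable)
  show pos: "0 < \<mu> i" if i: "i \<in> I" for i
  proof -
    have "0 \<le> \<mu> i"
      using e i orth[OF i i]
      by (intro eigenvalue_nonneg[OF rkhs compact L2[OF i]]) (auto simp: eigenfunctions_def)
    moreover have "\<mu> i \<noteq> 0" using \<mu> i by (auto simp: eigenvalue_enumeration_def)
    ultimately show ?thesis by simp
  qed
  have "finite {i \<in> I. 2 powi j < \<mu> i}" for j
    using finitely_many_large_eigenvalues[OF rkhs compact e pos] by simp
  then show "finite (dyadic_block I \<mu> j)" for j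
    by (rule rev_finite_subset) (auto simp: dyadic_block_def)
qed

theorem theorem3p4:
  fixes M :: "'a measure"
    and H :: "('a \<Rightarrow> real) set"
    and ip :: "('a \<Rightarrow> real) \<Rightarrow> ('a \<Rightarrow> real) \<Rightarrow> real"
    and k :: "'a \<Rightarrow> 'a \<Rightarrow> real"
    and I :: "nat set"
    and \<mu> :: "nat \<Rightarrow> real"
    and e :: "nat \<Rightarrow> 'a \<Rightarrow> real"
    and \<kappa> \<theta> :: real
    and r r' :: ennreal
  assumes "rkhs (space M) H ip k"
    and "(\<lambda>(x, y). k x y) \<in> borel_measurable (M \<Otimes>\<^sub>M M)"
    and "compactly_embedded M H ip"
    and "eigenvalue_enumeration M (kernel_operator M H ip) I \<mu>"
    and "eigenfunctions M H ip I \<mu> e"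
    and "\<kappa> > 0"
    and "0 < \<theta>" and "\<theta> < 1"
    and "1 \<le> r" and "1 \<le> r'" and "1 / r + 1 / r' = 1"
  shows
    "let seq_norm = (\<lambda>x. weighted_norm I \<mu> \<theta> r' (\<lambda>i. e i x * \<mu> i powr \<theta>));
         cond_i = ((SUP x\<in>space M. seq_norm x) \<le> ennreal \<kappa>);
         cond_ii = (esssup M seq_norm \<le> ennreal \<kappa>);
         cond_iii =
           (continuously_embedded M
              (power_space M I \<mu> e \<theta> r) (power_norm M I \<mu> e \<theta> r) (Linf M) (Linf_norm M) \<and>
            embedding_norm (power_space M I \<mu> e \<theta> r) (power_norm M I \<mu> e \<theta> r) (Linf_norm M)
              \<le> ennreal \<kappa>)
     in (cond_i \<longrightarrow> cond_ii) \<and> (cond_ii \<longrightarrow> cond_iii) \<and>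
        (sigma_finite_measure M \<and> bounded_kernel (space M) k \<longrightarrow>
           (cond_i \<longrightarrow> cond_ii) \<and> (cond_ii \<longleftrightarrow> cond_iii)) \<and>
        (separable_space (L2_topology M) \<and> topology_positive (initial_topology (space M) H) M \<longrightarrow>
           (cond_i \<longleftrightarrow> cond_ii) \<and> (cond_ii \<longleftrightarrow> cond_iii))"
proof -
  interpret orthonormal_system I \<mu> M e
    using assms(1,3-5) by (rule eigenfunctions_orthonormal_system)
  note conj = \<open>1 \<le> r\<close> \<open>1 \<le> r'\<close> \<open>1 / r + 1 / r' = 1\<close>
  have \<kappa>: "0 \<le> \<kappa>" using \<open>\<kappa> > 0\<close> by simp
  define cond_i where "cond_i \<longleftrightarrow> (SUP x\<in>space M. seq_norm \<theta> r' x) \<le> ennreal \<kappa>"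
  define cond_ii where "cond_ii \<longleftrightarrow> esssup M (seq_norm \<theta> r') \<le> ennreal \<kappa>"
  define cond_iii where "cond_iii \<longleftrightarrow> continuously_embedded M
      (power_space M I \<mu> e \<theta> r) (power_norm M I \<mu> e \<theta> r) (Linf M) (Linf_norm M) \<and>
    embedding_norm (power_space M I \<mu> e \<theta> r) (power_norm M I \<mu> e \<theta> r) (Linf_norm M) \<le> ennreal \<kappa>"
  have ii: "cond_ii \<longleftrightarrow> (AE x in M. seq_norm \<theta> r' x \<le> ennreal \<kappa>)"
    unfolding cond_ii_def by (rule esssup_le_iff[OF borel_measurable_seq_norm])
  have "cond_i \<longrightarrow> cond_ii"
    unfolding ii cond_i_def SUP_le_iff by (blast intro: AE_I2)
  moreover have "cond_ii \<longrightarrow> cond_iii"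
    unfolding ii cond_iii_def using embedding_if_AE_bounded[OF conj \<open>\<kappa> > 0\<close>] by blast
  moreover have "cond_iii \<longrightarrow> cond_ii"
    unfolding ii cond_iii_def using AE_bounded_if_embedding[OF conj \<kappa>] by blast
  moreover have "cond_iii \<longrightarrow> cond_i" if "topology_positive (initial_topology (space M) H) M"
  proof -
    have "e i \<in> H" if "i \<in> I" for i
      using \<open>eigenfunctions M H ip I \<mu> e\<close> that by (auto simp: eigenfunctions_def)
    then show ?thesis
      unfolding cond_i_def cond_iii_def SUP_le_iff
      using everywhere_bounded_if_embedding[OF conj \<kappa> _ assms(1) _ that] by blast
  qed
  ultimately show ?thesis
    unfolding Let_def cond_i_def[symmetric] cond_ii_def[symmetric] cond_iii_def[symmetric] by blast
qed

end
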